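(* For every positive integer $n>1$ and every type $t\ne(\infty,\infty,\ldots)$, there exist $2^{\aleph_0}$ pairwise non-quasi-isomorphic groups of rank $n$ and type $t$ in the class $\mathcal{MH}\cap\mathcal{NIL}$.
   Context: All groups are abelian. A multiplication on a group $G$ is a homomorphism $\mu\colon G\otimes G\to G$ (associativity is not required). A $nil$-group is a group on which the only multiplication is the zero multiplication. $\mathcal{NIL}$ is the class of all torsion-free $nil$-groups of finite rank. The $p$-rank $r_p(G)$ is the dimension of $G/pG$ over the field with $p$ elements. A Murley group is a reduced torsion-free group $G$ of finite rank such that $r_p(G)\le 1$ for every prime $p$. A torsion-free group is homogeneous if all its non-zero elements have the same type; this common type is called the type $t(G)$ of $G$. $\mathcal{MH}$ is the class of all homogeneous Murley groups. A characteristic is a family $(\chi_p)_p$ indexed by the primes with entries in $\{0,1,2,\ldots,\infty\}$; two characteristics are equivalent if they differ in only finitely many places, and only where both are finite; a type is an equivalence class of characteristics. The type of an element is the class of its characteristic $(h_p(g))_p$ of $p$-heights. Two groups $A$ and $B$ are quasi-isomorphic if there exist subgroups $A'\subseteq A$ and $B'\subseteq B$ such that $A'\cong B'$, $mA\subseteq A'$ and $nB\subseteq B'$ for some positive integers $m$ and $n$. *)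

theory Defs
  imports
    Complex_Main
    "HOL-Algebra.Free_Abelian_Groups"
    "HOL-Library.Extended_Nat"
    "HOL-Library.Equipollence"
    "HOL-Computational_Algebra.Primes"
begin

text \<open>
  Abelian groups are structures satisfying \<^const>\<open>comm_group\<close>; they are written
  multiplicatively, so the multiple $kx$ is \<open>x [^]\<^bsub>G\<^esub> k\<close>.
\<close>

subsection \<open>Multiplications and nil-groups\<close>

definition tensor_relations ::
  "('a, 'm) monoid_scheme \<Rightarrow> ('b, 'n) monoid_scheme \<Rightarrow> (('a \<times> 'b) \<Rightarrow>\<^sub>0 int) set" where
  "tensor_relations G H =
     {frag_of (x \<otimes>\<^bsub>G\<^esub> x', y) - frag_of (x, y) - frag_of (x', y) | x x' y.
        x \<in> carrier G \<and> x' \<in> carrier G \<and> y \<in> carrier H} \<union>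
     {frag_of (x, y \<otimes>\<^bsub>H\<^esub> y') - frag_of (x, y) - frag_of (x, y') | x y y'.
        x \<in> carrier G \<and> y \<in> carrier H \<and> y' \<in> carrier H}"

definition tensor_product ::
  "('a, 'm) monoid_scheme \<Rightarrow> ('b, 'n) monoid_scheme \<Rightarrow> (('a \<times> 'b) \<Rightarrow>\<^sub>0 int) set monoid" where
  "tensor_product G H =
     (let F = free_Abelian_group (carrier G \<times> carrier H)
      in F Mod (generate F (tensor_relations G H)))"

definition nil_group :: "('a, 'm) monoid_scheme \<Rightarrow> bool" where
  "nil_group G \<longleftrightarrow> comm_group G \<and>
     (\<forall>\<mu> \<in> hom (tensor_product G G) G. \<forall>u \<in> carrier (tensor_product G G). \<mu> u = \<one>\<^bsub>G\<^esub>)"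

subsection \<open>Rank and p-rank\<close>

text \<open>
  Linear independence with coefficients in the integers modulo \<open>m\<close>. For \<open>m = 0\<close> this is
  independence over the integers; for \<open>m = p\<close> prime and a group annihilated by \<open>p\<close> it is
  linear independence over the field with \<open>p\<close> elements.
\<close>

definition lin_indep :: "nat \<Rightarrow> ('a, 'm) monoid_scheme \<Rightarrow> 'a set \<Rightarrow> bool" where
  "lin_indep m G B \<longleftrightarrow> B \<subseteq> carrier G \<and>
     (\<forall>S (c :: 'a \<Rightarrow> int). finite S \<longrightarrow> S \<subseteq> B \<longrightarrow>
        finprod G (\<lambda>x. x [^]\<^bsub>G\<^esub> c x) S = \<one>\<^bsub>G\<^esub> \<longrightarrow> (\<forall>x\<in>S. int m dvd c x))"

definition max_lin_indep :: "nat \<Rightarrow> ('a, 'm) monoid_scheme \<Rightarrow> 'a set \<Rightarrow> bool" where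
  "max_lin_indep m G B \<longleftrightarrow> lin_indep m G B \<and> (\<forall>B'. lin_indep m G B' \<longrightarrow> B \<subseteq> B' \<longrightarrow> B' = B)"

text \<open>
  All maximal independent sets of a torsion-free group, and all bases of a vector space, have
  the same cardinality, so the following relations are single-valued there; they hold for
  no \<open>n\<close> if the (p-)rank is infinite.
\<close>

definition has_rank :: "('a, 'm) monoid_scheme \<Rightarrow> nat \<Rightarrow> bool" where
  "has_rank G n \<longleftrightarrow> (\<exists>B. max_lin_indep 0 G B \<and> finite B \<and> card B = n)"

definition multiples :: "('a, 'm) monoid_scheme \<Rightarrow> nat \<Rightarrow> 'a set" where
  "multiples G k = (\<lambda>x. x [^]\<^bsub>G\<^esub> k) ` carrier G"

definition has_p_rank :: "nat \<Rightarrow> ('a, 'm) monoid_scheme \<Rightarrow> nat \<Rightarrow> bool" where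
  "has_p_rank p G n \<longleftrightarrow>
     (\<exists>B. max_lin_indep p (G Mod (multiples G p)) B \<and> finite B \<and> card B = n)"

subsection \<open>Torsion-free and reduced groups, the class NIL, Murley groups\<close>

definition torsion_free :: "('a, 'm) monoid_scheme \<Rightarrow> bool" where
  "torsion_free G \<longleftrightarrow>
     (\<forall>x\<in>carrier G. \<forall>k::nat. k > 0 \<longrightarrow> x [^]\<^bsub>G\<^esub> k = \<one>\<^bsub>G\<^esub> \<longrightarrow> x = \<one>\<^bsub>G\<^esub>)"

definition divisible :: "('a, 'm) monoid_scheme \<Rightarrow> bool" where
  "divisible G \<longleftrightarrow> (\<forall>k::nat. k > 0 \<longrightarrow> (\<forall>x\<in>carrier G. \<exists>y\<in>carrier G. y [^]\<^bsub>G\<^esub> k = x))"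

definition reduced :: "('a, 'm) monoid_scheme \<Rightarrow> bool" where
  "reduced G \<longleftrightarrow> (\<forall>D. subgroup D G \<longrightarrow> divisible (G\<lparr>carrier := D\<rparr>) \<longrightarrow> D = {\<one>\<^bsub>G\<^esub>})"

definition NIL :: "('a, 'm) monoid_scheme \<Rightarrow> bool" where
  "NIL G \<longleftrightarrow> comm_group G \<and> torsion_free G \<and> (\<exists>n. has_rank G n) \<and> nil_group G"

definition Murley :: "('a, 'm) monoid_scheme \<Rightarrow> bool" where
  "Murley G \<longleftrightarrow> comm_group G \<and> reduced G \<and> torsion_free G \<and> (\<exists>n. has_rank G n) \<and>
     (\<forall>p. prime p \<longrightarrow> (\<exists>r\<le>1. has_p_rank p G r))"

subsection \<open>Characteristics and types\<close>

text \<open>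
  A characteristic is a function on \<^typ>\<open>nat\<close> of which only the values at primes matter:
  characteristics that agree at all primes are equivalent.
\<close>

definition char_rel :: "((nat \<Rightarrow> enat) \<times> (nat \<Rightarrow> enat)) set" where
  "char_rel = {(\<chi>, \<psi>). finite {p. prime p \<and> \<chi> p \<noteq> \<psi> p} \<and>
     (\<forall>p. prime p \<longrightarrow> \<chi> p \<noteq> \<psi> p \<longrightarrow> \<chi> p \<noteq> \<infinity> \<and> \<psi> p \<noteq> \<infinity>)}"

definition type_of_char :: "(nat \<Rightarrow> enat) \<Rightarrow> (nat \<Rightarrow> enat) set" where
  "type_of_char \<chi> = char_rel `` {\<chi>}"

definition types :: "(nat \<Rightarrow> enat) set set" where
  "types = UNIV // char_rel"

lemma equiv_char_rel: "equiv UNIV char_rel"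
proof (rule equivI)
  show "char_rel \<subseteq> UNIV \<times> UNIV" by simp
  show "refl char_rel" by (simp add: refl_on_def char_rel_def)
  show "sym char_rel"
  proof (rule symI)
    fix \<chi> \<psi> assume "(\<chi>, \<psi>) \<in> char_rel"
    then have *: "finite {p. prime p \<and> \<chi> p \<noteq> \<psi> p}"
      "\<And>p. prime p \<Longrightarrow> \<chi> p \<noteq> \<psi> p \<Longrightarrow> \<chi> p \<noteq> \<infinity> \<and> \<psi> p \<noteq> \<infinity>"
      unfolding char_rel_def by blast+
    have "finite {p. prime p \<and> \<psi> p \<noteq> \<chi> p}"
      by (rule finite_subset[OF _ *(1)]) force
    moreover have "\<psi> p \<noteq> \<infinity> \<and> \<chi> p \<noteq> \<infinity>" if "prime p" "\<psi> p \<noteq> \<chi> p" for p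
      using *(2)[OF that(1)] that(2) by force
    ultimately show "(\<psi>, \<chi>) \<in> char_rel" unfolding char_rel_def by blast
  qed
  show "trans char_rel"
  proof (rule transI)
    fix \<chi> \<psi> \<phi> assume "(\<chi>, \<psi>) \<in> char_rel" "(\<psi>, \<phi>) \<in> char_rel"
    then have *: "finite {p. prime p \<and> \<chi> p \<noteq> \<psi> p}" "finite {p. prime p \<and> \<psi> p \<noteq> \<phi> p}"
      "\<And>p. prime p \<Longrightarrow> \<chi> p \<noteq> \<psi> p \<Longrightarrow> \<chi> p \<noteq> \<infinity> \<and> \<psi> p \<noteq> \<infinity>"
      "\<And>p. prime p \<Longrightarrow> \<psi> p \<noteq> \<phi> p \<Longrightarrow> \<psi> p \<noteq> \<infinity> \<and> \<phi> p \<noteq> \<infinity>"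
      unfolding char_rel_def by blast+
    have "finite {p. prime p \<and> \<chi> p \<noteq> \<phi> p}"
      by (rule finite_subset[OF _ finite_UnI[OF *(1,2)]]) force
    moreover have "\<chi> p \<noteq> \<infinity> \<and> \<phi> p \<noteq> \<infinity>" if "prime p" "\<chi> p \<noteq> \<phi> p" for p
      using *(3,4)[OF that(1)] that(2) by (cases "\<chi> p = \<psi> p"; cases "\<psi> p = \<phi> p") force+
    ultimately show "(\<chi>, \<phi>) \<in> char_rel" unfolding char_rel_def by blast
  qed
qed

definition p_height :: "nat \<Rightarrow> ('a, 'm) monoid_scheme \<Rightarrow> 'a \<Rightarrow> enat" where
  "p_height p G g = Sup {enat k | k. \<exists>x\<in>carrier G. x [^]\<^bsub>G\<^esub> (p ^ k) = g}"

definition elem_type :: "('a, 'm) monoid_scheme \<Rightarrow> 'a \<Rightarrow> (nat \<Rightarrow> enat) set" where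
  "elem_type G g = type_of_char (\<lambda>p. p_height p G g)"

definition homogeneous :: "('a, 'm) monoid_scheme \<Rightarrow> bool" where
  "homogeneous G \<longleftrightarrow> comm_group G \<and> torsion_free G \<and>
     (\<forall>x \<in> carrier G - {\<one>\<^bsub>G\<^esub>}. \<forall>y \<in> carrier G - {\<one>\<^bsub>G\<^esub>}. elem_type G x = elem_type G y)"

text \<open>Only meaningful for nontrivial homogeneous groups.\<close>

definition group_type :: "('a, 'm) monoid_scheme \<Rightarrow> (nat \<Rightarrow> enat) set" where
  "group_type G = (THE t. \<forall>x \<in> carrier G - {\<one>\<^bsub>G\<^esub>}. elem_type G x = t)"

definition MH :: "('a, 'm) monoid_scheme \<Rightarrow> bool" where
  "MH G \<longleftrightarrow> Murley G \<and> homogeneous G"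

subsection \<open>Quasi-isomorphism\<close>

definition quasi_isomorphic :: "('a, 'm) monoid_scheme \<Rightarrow> ('b, 'n) monoid_scheme \<Rightarrow> bool" where
  "quasi_isomorphic A B \<longleftrightarrow>
     (\<exists>A' B'. subgroup A' A \<and> subgroup B' B \<and> A\<lparr>carrier := A'\<rparr> \<cong> B\<lparr>carrier := B'\<rparr> \<and>
        (\<exists>m n :: nat. m > 0 \<and> n > 0 \<and> multiples A m \<subseteq> A' \<and> multiples B n \<subseteq> B'))"

end

theory Submission
  imports Defs "HOL-Computational_Algebra.Polynomial"
begin

text \<open>
  A polynomial of degree less than $n$ over the rationals is identified with its coefficient
  vector, so that a point $a$ of $\<int>_p$ gives the additive map $P \mapsto P(a)$ from
  $\<rat>^n$ to the $p$-adic numbers. For a transcendental point $a_p$ at every prime $p$ and a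
  characteristic $\chi$, the group
  $L = \{P. \deg P < n,\ v_p(P(a_p)) \ge - \chi_p$ whenever $\chi_p < \infty\}$
  has rank $n$. An element $P$ of $L$ is divisible by $p^j$ in $L$ exactly if
  $v_p(P(a_p)) \ge j - \chi_p$, so its $p$-height is $v_p(P(a_p)) + \chi_p$. This makes everything
  about $L$ visible in the numbers $P(a_p)$.

  \<^item> Modulo $p L$ only the residue of $p^{\chi_p} P(a_p)$ modulo $p$ matters, so $r_p(L) \le 1$.
  \<^item> Heights of non-zero elements are finite at the primes with $\chi_p < \infty$ because $a_p$ is
    transcendental. For such a prime this also shows that $L$ is reduced.
  \<^item> All elements have the type of $\chi$ if for each $P \neq 0$ the number $P(a_p)$ is a unit for
    almost all $p$. For this $a_p$ is taken congruent modulo $p$ to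
    $r_p = \lfloor p^{1/n} \rfloor$: if $P$ has integer coefficients and $p$ is large then
    $0 < |P(r_p)| < r_p^n \le p$.
  \<^item> A biadditive map $\beta$ on $L$ is continuous for the $p$-adic topology, for a fixed prime with
    $\chi_p < \infty$, and the integers are dense among the $P$ with integral $P(a_p)$. Hence $\beta(P, Q) = \beta(1, 1) P Q$
    whenever $P(a_p)$ and $Q(a_p)$ are integral, first after evaluation at $a_p$ and then as
    polynomials. With $P = Q = X^{n-1}$ the right side has degree at least
    $2 n - 2 \ge n$ unless $\beta(1, 1) = 0$. Therefore $L$ is a nil-group.
  \<^item> A quasi-isomorphism from the group of the points $a$ to the group of the points $b$ multiplies
    all values by one $p$-adic constant. The images $P$ and $Q$ of (a multiple of) $1$ and $X$
    satisfy $P(b_p) a_p = Q(b_p)$ with $P \neq 0$, so $a_p$ is determined by $b_p$ and a pair of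
    rational polynomials, and only countably many $a$ belong to a given $b$.

  Points with these properties are the Liouville numbers \<open>liouville\<close>, one for each set of natural
  numbers, whose sparse $p$-adic expansions make transcendence a matter of size
  (\<open>liouville_transcendental\<close>). A maximal set of pairwise non-quasi-isomorphic groups among these
  $2^{\aleph_0}$ groups has cardinality $2^{\aleph_0}$, because countable sets indexed by it cover
  everything. The main steps are \<open>p_rank_le_1\<close>, \<open>elem_type_lattice\<close>, \<open>nil_lattice\<close> and
  \<open>quasi_isomorphic_imp_solves_for_point\<close>.

  The $p$-adic numbers are never formed: a point is a sequence of integers converging to it, and
  $v_p(P(a)) \ge k$ means that $p^{-k} P$ is eventually $p$-integral along this sequence.
\<close>

section \<open>Rational numbers integral at a prime\<close>

definition p_integral :: "nat \<Rightarrow> rat \<Rightarrow> bool" where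
  "p_integral p r \<longleftrightarrow> (\<exists>a b :: int. \<not> int p dvd b \<and> r * of_int b = of_int a)"

lemma p_integralI: "\<not> int p dvd b \<Longrightarrow> r * of_int b = of_int a \<Longrightarrow> p_integral p r"
  unfolding p_integral_def by blast

lemma p_integral_of_int [simp]: "prime p \<Longrightarrow> p_integral p (of_int m)"
  by (rule p_integralI[of _ 1 _ m]) (auto simp: prime_int_iff dest: prime_nat_iff[THEN iffD1])

lemma p_integral_0 [simp]: "prime p \<Longrightarrow> p_integral p 0"
  using p_integral_of_int[of p 0] by simp

lemma p_integral_add:
  assumes "prime p" "p_integral p r" "p_integral p r'"
  shows "p_integral p (r + r')"
proof -
  obtain a b a' b' where *: "\<not> int p dvd b" "r * of_int b = of_int a"
    "\<not> int p dvd b'" "r' * of_int b' = of_int a'"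
    using assms(2,3) unfolding p_integral_def by blast
  have "prime (int p)" using assms(1) by simp
  have "(r + r') * of_int (b * b') = (r * of_int b) * of_int b' + (r' * of_int b') * of_int b"
    by (simp add: algebra_simps)
  also have "\<dots> = of_int (a * b' + a' * b)" using * by simp
  finally show ?thesis
    using p_integralI[of p "b * b'"] *(1,3) prime_dvd_mult_iff[OF \<open>prime (int p)\<close>] by blast
qed

lemma p_integral_mult:
  assumes "prime p" "p_integral p r" "p_integral p r'"
  shows "p_integral p (r * r')"
proof -
  obtain a b a' b' where *: "\<not> int p dvd b" "r * of_int b = of_int a"
    "\<not> int p dvd b'" "r' * of_int b' = of_int a'"
    using assms(2,3) unfolding p_integral_def by blast
  have "prime (int p)" using assms(1) by simp
  have "(r * r') * of_int (b * b') = (r * of_int b) * (r' * of_int b')"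
    by (simp add: algebra_simps)
  also have "\<dots> = of_int (a * a')" using * by simp
  finally show ?thesis
    using p_integralI[of p "b * b'"] *(1,3) prime_dvd_mult_iff[OF \<open>prime (int p)\<close>] by blast
qed

lemma p_integral_diff:
  assumes "prime p" "p_integral p r" "p_integral p r'"
  shows "p_integral p (r - r')"
  using p_integral_add[OF assms(1,2) p_integral_mult[OF assms(1) p_integral_of_int[OF assms(1), of "-1"] assms(3)]]
  by simp

lemma p_integral_divide_power_iff:
  assumes "prime p"
  shows "p_integral p (of_int m / of_nat p ^ k) \<longleftrightarrow> int p ^ k dvd m"
proof
  have "p > 0" "prime (int p)" using assms by (auto simp: prime_gt_0_nat)
  assume "p_integral p (of_int m / of_nat p ^ k)"
  then obtain a b where *: "\<not> int p dvd b" "of_int m / of_nat p ^ k * of_int b = (of_int a :: rat)"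
    unfolding p_integral_def by blast
  then have "(of_int (m * b) :: rat) = of_int (a * int p ^ k)"
    using \<open>p > 0\<close> by (simp add: field_simps)
  then have "m * b = a * int p ^ k" by (simp only: of_int_eq_iff)
  then have "int p ^ k dvd m * b" by simp
  moreover have "coprime (int p ^ k) b"
    using \<open>prime (int p)\<close> *(1) by (simp add: prime_imp_coprime)
  ultimately show "int p ^ k dvd m" using coprime_dvd_mult_left_iff by blast
next
  have "p > 0" using assms by (auto simp: prime_gt_0_nat)
  assume "int p ^ k dvd m"
  then obtain c where "m = int p ^ k * c" by blast
  then have "of_int m / of_nat p ^ k = (of_int c :: rat)" using \<open>p > 0\<close> by (simp add: field_simps)
  then show "p_integral p (of_int m / of_nat p ^ k)" using assms by simp
qed

text \<open>
  The integers are dense in the local ring at $p$: the denominator of $r$ is invertible modulo $p^k$.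
\<close>
lemma p_integral_approx:
  assumes "prime p" "p_integral p r"
  obtains m :: int where "p_integral p ((r - of_int m) / of_nat p ^ k)"
proof -
  have "p > 0" "prime (int p)" using assms by (auto simp: prime_gt_0_nat)
  obtain a b where *: "\<not> int p dvd b" "r * of_int b = of_int a"
    using assms(2) unfolding p_integral_def by blast
  have "coprime b (int p ^ k)"
    using prime_imp_coprime[OF \<open>prime (int p)\<close> *(1)] by (simp add: coprime_commute)
  then obtain c z where cz: "b * c + int p ^ k * z = 1"
    by (metis bezout_int mult.commute coprime_imp_gcd_eq_1)
  have "(r - of_int (a * c)) * of_int b = of_int (a * (1 - b * c))"
    using * by (simp add: algebra_simps)
  also have "1 - b * c = int p ^ k * z" using cz by simp
  also have "of_int (a * (int p ^ k * z)) = of_nat p ^ k * (of_int (a * z) :: rat)" by simp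
  finally have "(r - of_int (a * c)) / of_nat p ^ k * of_int b = of_int (a * z)"
    using \<open>p > 0\<close> by (simp add: field_simps)
  then show ?thesis using that p_integralI *(1) by blast
qed

lemma p_integral_power_multiple:
  assumes "prime p"
  obtains j where "p_integral p (of_nat p ^ j * r)"
proof -
  have "prime (int p)" using assms by simp
  obtain a b where ab: "r = of_int a / of_int b" "b > 0"
    by (metis quotient_of_div quotient_of_denom_pos prod.collapse)
  have "\<not> is_unit (int p)" using \<open>prime (int p)\<close> by (metis not_prime_unit)
  then obtain c where c: "b = int p ^ multiplicity (int p) b * c" "\<not> int p dvd c"
    using multiplicity_decompose'[of b "int p"] ab(2) by force
  have "of_int b = of_nat p ^ multiplicity (int p) b * (of_int c :: rat)"
    by (subst c(1)) simp
  moreover have "c \<noteq> 0" "p \<noteq> 0" using c(2) assms by auto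
  ultimately have "of_nat p ^ multiplicity (int p) b * r * of_int c = of_int a"
    using ab(1) by simp
  then show ?thesis using c(2) p_integralI that by blast
qed

lemma p_integral_poly:
  assumes "prime p" "\<And>i. p_integral p (coeff P i)"
  shows "p_integral p (poly P (of_int y))"
  using assms(2)
proof (induction P)
  case 0
  then show ?case using assms(1) by simp
next
  case (pCons c P)
  have "p_integral p c" using pCons.prems[of 0] by simp
  moreover have "p_integral p (coeff P i)" for i using pCons.prems[of "Suc i"] by simp
  ultimately show ?case
    using pCons.IH by (simp add: p_integral_add p_integral_mult assms(1))
qed

text \<open>
  The factor $y - z$ of $P(y) - P(z)$ carries over to the local ring at $p$.
\<close>
lemma p_integral_poly_diff:
  assumes "prime p" "\<And>i. p_integral p (coeff P i)" "int p ^ k dvd y - z"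
  shows "p_integral p ((poly P (of_int y) - poly P (of_int z)) / of_nat p ^ k)"
  using assms(2)
proof (induction P)
  case 0
  then show ?case using assms(1) by simp
next
  case (pCons c P)
  have *: "p_integral p (coeff P i)" for i using pCons.prems[of "Suc i"] by simp
  have "(poly (pCons c P) (of_int y) - poly (pCons c P) (of_int z)) / of_nat p ^ k =
    of_int y * ((poly P (of_int y) - poly P (of_int z)) / of_nat p ^ k)
    + of_int (y - z) / of_nat p ^ k * poly P (of_int z)"
    by (simp add: divide_inverse algebra_simps)
  moreover have "p_integral p (of_int (y - z) / of_nat p ^ k)"
    using assms(3) p_integral_divide_power_iff[OF assms(1)] by blast
  ultimately show ?case
    using pCons.IH[OF *] p_integral_poly[OF assms(1) *] p_integral_of_int[OF assms(1)]
    by (simp only: p_integral_add p_integral_mult assms(1))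
qed

section \<open>Polynomials evaluated at a p-adic integer\<close>

text \<open>
  For a sequence \<open>s\<close> converging to a $p$-adic integer $a$ this says $v_p(P(a)) \<ge> k$.
\<close>
definition val_ge :: "nat \<Rightarrow> (nat \<Rightarrow> int) \<Rightarrow> int \<Rightarrow> rat poly \<Rightarrow> bool" where
  "val_ge p s k P \<longleftrightarrow>
     (\<forall>\<^sub>F i in sequentially. p_integral p (of_nat p powi (- k) * poly P (of_int (s i))))"

locale padic_integer =
  fixes p :: nat and s :: "nat \<Rightarrow> int"
  assumes prime_p: "prime p"
    and cauchy: "\<And>k. \<exists>N. \<forall>i\<ge>N. int p ^ k dvd s i - s N"
begin

lemma p_nz: "(of_nat p :: rat) \<noteq> 0"
  using prime_p by (simp add: prime_nat_iff) 

lemma val_ge_0 [simp]: "val_ge p s k 0"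
  using prime_p by (simp add: val_ge_def)

lemma val_ge_add: "val_ge p s k P \<Longrightarrow> val_ge p s k Q \<Longrightarrow> val_ge p s k (P + Q)"
  unfolding val_ge_def
  by (erule (1) eventually_elim2) (auto simp: distrib_left intro!: p_integral_add[OF prime_p])

lemma val_ge_mult: "val_ge p s k P \<Longrightarrow> val_ge p s l Q \<Longrightarrow> val_ge p s (k + l) (P * Q)"
  unfolding val_ge_def
proof (erule (1) eventually_elim2)
  fix i
  assume "p_integral p (of_nat p powi (- k) * poly P (of_int (s i)))"
    "p_integral p (of_nat p powi (- l) * poly Q (of_int (s i)))"
  then have "p_integral p ((of_nat p powi (- k) * poly P (of_int (s i))) *
    (of_nat p powi (- l) * poly Q (of_int (s i))))"
    by (rule p_integral_mult[OF prime_p])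
  moreover have "(of_nat p :: rat) powi (- (k + l)) = of_nat p powi (- k) * of_nat p powi (- l)"
    using p_nz by (simp flip: power_int_add)
  ultimately show "p_integral p (of_nat p powi (- (k + l)) * poly (P * Q) (of_int (s i)))"
    by (simp add: mult_ac)
qed

lemma val_ge_smult: "p_integral p r \<Longrightarrow> val_ge p s k P \<Longrightarrow> val_ge p s k (smult r P)"
  unfolding val_ge_def
  by (erule eventually_mono) (auto simp: mult.left_commute intro!: p_integral_mult[OF prime_p])

lemma val_ge_uminus: "val_ge p s k P \<Longrightarrow> val_ge p s k (- P)"
  using val_ge_smult[OF p_integral_of_int[OF prime_p, of "-1"]] by simp

lemma val_ge_diff: "val_ge p s k P \<Longrightarrow> val_ge p s k Q \<Longrightarrow> val_ge p s k (P - Q)"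
  using val_ge_add[of k P "- Q"] val_ge_uminus by simp

lemma val_ge_smult_powi: "val_ge p s k (smult (of_nat p powi j) P) \<longleftrightarrow> val_ge p s (k - j) P"
proof -
  have "(of_nat p :: rat) powi (- (k - j)) = of_nat p powi (- k) * of_nat p powi j"
    using p_nz by (simp flip: power_int_add)
  then show ?thesis unfolding val_ge_def by (simp add: mult_ac)
qed

lemma val_ge_smult_power: "val_ge p s k (smult (of_nat p ^ j) P) \<longleftrightarrow> val_ge p s (k - int j) P"
  using val_ge_smult_powi[of k "int j" P] by simp

lemma val_ge_mono:
  assumes "val_ge p s k P" "l \<le> k" shows "val_ge p s l P"
proof -
  have "val_ge p s (k - int (nat (k - l))) P"
    unfolding val_ge_smult_power[symmetric]
    using val_ge_smult[OF p_integral_of_int[OF prime_p, of "int p ^ nat (k - l)"] assms(1)] by simp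
  then show ?thesis using assms(2) by simp
qed

lemma val_ge_smult_unit:
  assumes "\<not> int p dvd u"
  shows "val_ge p s k (smult (of_int u) P) \<longleftrightarrow> val_ge p s k P"
proof
  assume "val_ge p s k (smult (of_int u) P)"
  moreover have "u \<noteq> 0" using assms by auto
  then have "p_integral p (1 / of_int u)"
    using assms by (intro p_integralI[of p u _ 1]) auto
  ultimately have "val_ge p s k (smult (1 / of_int u) (smult (of_int u) P))"
    by (rule val_ge_smult[rotated])
  then show "val_ge p s k P" using \<open>u \<noteq> 0\<close> by simp
next
  assume "val_ge p s k P"
  then show "val_ge p s k (smult (of_int u) P)"
    using val_ge_smult[OF p_integral_of_int[OF prime_p]] by blast
qed

lemma val_ge_integral:
  assumes "\<And>i. p_integral p (coeff P i)" shows "val_ge p s 0 P"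
  unfolding val_ge_def using p_integral_poly[OF prime_p assms] by simp

lemma val_ge_const: "val_ge p s (int k) [:of_int m:] \<longleftrightarrow> int p ^ k dvd m"
proof -
  have "(of_nat p :: rat) powi (- int k) * of_int m = of_int m / of_nat p ^ k"
    by (simp add: power_int_minus field_simps)
  then show ?thesis
    using p_integral_divide_power_iff[OF prime_p] by (simp add: val_ge_def)
qed

lemma power_multiple_coeffs:
  obtains j where "\<And>i. p_integral p (coeff (smult (of_nat p ^ j) P) i)"
proof -
  have "\<exists>j. \<forall>i. p_integral p (coeff (smult (of_nat p ^ j) P) i)"
  proof (induction P)
    case 0
    then show ?case using prime_p by simp
  next
    case (pCons c P)
    then obtain j where j: "\<And>i. p_integral p (coeff (smult (of_nat p ^ j) P) i)" by blast
    obtain j' where j': "p_integral p (of_nat p ^ j' * c)"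
      using p_integral_power_multiple[OF prime_p] .
    have "p_integral p (coeff (smult (of_nat p ^ (j + j')) (pCons c P)) i)" for i
    proof (cases i)
      case 0
      then show ?thesis
        using p_integral_mult[OF prime_p p_integral_of_int[OF prime_p, of "int p ^ j"] j']
        by (simp add: power_add mult_ac)
    next
      case (Suc i')
      then show ?thesis
        using p_integral_mult[OF prime_p p_integral_of_int[OF prime_p, of "int p ^ j'"] j[of i']]
        by (simp add: power_add mult_ac)
    qed
    then show ?case by blast
  qed
  then show ?thesis using that by blast
qed

lemma eventually_congruent: "\<forall>\<^sub>F i in sequentially. \<forall>j\<ge>i. int p ^ k dvd s j - s i"
proof -
  obtain N where N: "\<And>i. i \<ge> N \<Longrightarrow> int p ^ k dvd s i - s N" using cauchy by blast
  have "int p ^ k dvd s j - s i" if "i \<ge> N" "j \<ge> i" for i j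
    using dvd_diff[OF N[of j] N[of i]] that by simp
  then show ?thesis unfolding eventually_sequentially by blast
qed

text \<open>
  The terms of the sequence are integers approximating the point, which is the value of $X$.
\<close>
lemma eventually_val_ge_linear: "\<forall>\<^sub>F i in sequentially. val_ge p s (int k) [:- of_int (s i), 1:]"
proof (rule eventually_mono[OF eventually_congruent[of k]])
  fix i assume *: "\<forall>j\<ge>i. int p ^ k dvd s j - s i"
  have "p_integral p (of_nat p powi (- int k) * poly [:- of_int (s i), 1:] (of_int (s j)))"
    if "j \<ge> i" for j
  proof -
    have "of_nat p powi (- int k) * poly [:- of_int (s i), 1:] (of_int (s j)) =
        (of_int (s j - s i) / of_nat p ^ k :: rat)"
      by (simp add: power_int_minus field_simps)
    then show ?thesis using * that p_integral_divide_power_iff[OF prime_p] by metis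
  qed
  then show "val_ge p s (int k) [:- of_int (s i), 1:]"
    unfolding val_ge_def eventually_sequentially by blast
qed

lemma eventually_poly_diff:
  "\<forall>\<^sub>F i in sequentially. \<forall>j\<ge>i.
     p_integral p ((poly P (of_int (s j)) - poly P (of_int (s i))) / of_nat p ^ k)"
proof -
  obtain m where m: "\<And>i. p_integral p (coeff (smult (of_nat p ^ m) P) i)"
    using power_multiple_coeffs[of P] by blast
  show ?thesis
  proof (rule eventually_mono[OF eventually_congruent[of "k + m"]], intro allI impI)
    fix i j assume *: "\<forall>j\<ge>i. int p ^ (k + m) dvd s j - s i" and "i \<le> j"
    have "p_integral p ((poly (smult (of_nat p ^ m) P) (of_int (s j))
        - poly (smult (of_nat p ^ m) P) (of_int (s i))) / of_nat p ^ (k + m))"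
      using p_integral_poly_diff[OF prime_p m] * \<open>i \<le> j\<close> by blast
    moreover have "(poly (smult (of_nat p ^ m) P) (of_int (s j))
        - poly (smult (of_nat p ^ m) P) (of_int (s i))) / of_nat p ^ (k + m)
      = (poly P (of_int (s j)) - poly P (of_int (s i))) / of_nat p ^ k"
      using p_nz by (simp add: field_simps power_add)
    ultimately show "p_integral p ((poly P (of_int (s j)) - poly P (of_int (s i))) / of_nat p ^ k)"
      by simp
  qed
qed

text \<open>
  The $p$-adic completion has residue field $\<int> / p$ and the integers are dense in its ring of
  integers. This is the source of the bound on the $p$-rank and of the rigidity of multiplications.
\<close>
lemma val_ge_approx:
  assumes "val_ge p s 0 P"
  obtains m :: int where "val_ge p s (int k) (P - [:of_int m:])"
proof -
  have "\<forall>\<^sub>F i in sequentially. p_integral p (poly P (of_int (s i)))"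
    using assms unfolding val_ge_def by simp
  then obtain i where i: "p_integral p (poly P (of_int (s i)))"
    "\<And>j. j \<ge> i \<Longrightarrow> p_integral p ((poly P (of_int (s j)) - poly P (of_int (s i))) / of_nat p ^ k)"
    using eventually_happens[OF eventually_conj[OF _ eventually_poly_diff[of P k]]] by force
  \<comment> \<open>beyond this index the values of \<open>P\<close> agree modulo \<open>p ^ k\<close>, so one integer approximates them all\<close>
  obtain m where m: "p_integral p ((poly P (of_int (s i)) - of_int m) / of_nat p ^ k)"
    using p_integral_approx[OF prime_p i(1)] .
  have "p_integral p (of_nat p powi (- int k) * poly (P - [:of_int m:]) (of_int (s j)))" if "j \<ge> i" for j
  proof -
    have "of_nat p powi (- int k) * poly (P - [:of_int m:]) (of_int (s j)) =
        (poly P (of_int (s j)) - poly P (of_int (s i))) / of_nat p ^ k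
        + (poly P (of_int (s i)) - of_int m) / of_nat p ^ k"
      by (simp add: power_int_minus divide_inverse algebra_simps)
    then show ?thesis using p_integral_add[OF prime_p i(2)[OF that] m] by simp
  qed
  then have "val_ge p s (int k) (P - [:of_int m:])"
    unfolding val_ge_def eventually_sequentially by blast
  then show ?thesis using that by blast
qed

end

section \<open>Liouville numbers\<close>

text \<open>
  The common source of the two size estimates: for the terms of a Liouville number, and for the
  residues that make values units at almost all primes.
\<close>
lemma poly_eventually_small_nonzero:
  fixes P :: "rat poly"
  assumes "P \<noteq> 0" "degree P < n"
  obtains R where "\<And>y :: nat. y \<ge> R \<Longrightarrow> poly P (of_nat y) \<noteq> 0 \<and> \<bar>poly P (of_nat y)\<bar> < of_nat y ^ n"
proof -
  have "finite {y :: nat. poly P (of_nat y) = 0}"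
    using finite_vimageI[OF poly_roots_finite[OF assms(1)], of of_nat]
    by (simp add: vimage_def)
  then obtain R1 where R1: "\<And>y :: nat. poly P (of_nat y) = 0 \<Longrightarrow> y < R1"
    unfolding finite_nat_set_iff_bounded by blast
  define A where "A = (\<Sum>i\<le>degree P. \<bar>coeff P i\<bar>)"
  obtain R2 where R2: "A < of_nat R2" using reals_Archimedean2 by blast
  have "\<bar>poly P (of_nat y)\<bar> < of_nat y ^ n" if "y \<ge> max R2 1" for y :: nat
  proof -
    have y: "(1 :: rat) \<le> of_nat y" using that by simp
    have "\<bar>poly P (of_nat y)\<bar> \<le> (\<Sum>i\<le>degree P. \<bar>coeff P i * of_nat y ^ i\<bar>)"
      unfolding poly_altdef by (rule sum_abs)
    also have "\<dots> \<le> (\<Sum>i\<le>degree P. \<bar>coeff P i\<bar> * of_nat y ^ degree P)"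
      using y by (intro sum_mono) (simp add: abs_mult mult_left_mono power_increasing)
    also have "\<dots> = A * of_nat y ^ degree P" by (simp add: A_def sum_distrib_right)
    also have "\<dots> < of_nat y * of_nat y ^ degree P"
      using R2 that y by (intro mult_strict_right_mono) (auto intro: less_le_trans)
    also have "\<dots> \<le> of_nat y ^ n"
      using power_increasing[of "Suc (degree P)" n "of_nat y :: rat"] y assms(2) by simp
    finally show ?thesis .
  qed
  then show ?thesis
    using R1 by (intro that[of "max R1 (max R2 1)"]) (force simp flip: not_less)
qed

lemma common_denominator:
  fixes P :: "rat poly"
  obtains d :: nat where "d > 0" "\<And>i. coeff (smult (of_nat d) P) i \<in> \<int>"
proof -
  have "\<exists>d::nat. d > 0 \<and> (\<forall>i. coeff (smult (of_nat d) P) i \<in> \<int>)"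
  proof (induction P)
    case 0
    then show ?case by (auto intro: exI[of _ 1])
  next
    case (pCons c P)
    then obtain d :: nat where d: "d > 0" "\<And>i. coeff (smult (of_nat d) P) i \<in> \<int>" by blast
    obtain a b where ab: "c = of_int a / of_int b" "b > 0"
      by (metis quotient_of_div quotient_of_denom_pos prod.collapse)
    have "coeff (smult (of_nat (d * nat b)) (pCons c P)) i \<in> \<int>" for i
    proof (cases i)
      case 0
      then have "coeff (smult (of_nat (d * nat b)) (pCons c P)) i = of_int (int d * a)"
        using ab by simp
      then show ?thesis by (simp only: Ints_of_int)
    next
      case (Suc i')
      then have "coeff (smult (of_nat (d * nat b)) (pCons c P)) i =
          of_nat (nat b) * coeff (smult (of_nat d) P) i'" by simp
      then show ?thesis using d(2)[of i'] by (simp only: Ints_mult Ints_of_nat)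
    qed
    then show ?case using d(1) ab(2) by (intro exI[of _ "d * nat b"]) auto
  qed
  then show ?thesis using that by blast
qed

lemma poly_in_Ints:
  assumes "\<And>i. coeff P i \<in> \<int>" "y \<in> \<int>"
  shows "poly P y \<in> \<int>"
  unfolding poly_altdef by (intro Ints_sum Ints_mult Ints_power assms)

text \<open>
  The partial sums of a $p$-adic Liouville number whose digits $1$ and $2$ record the set \<open>S\<close>. The
  exponent of the next power of $p$ is $s_i^i$, so that a non-zero value at $s_i$ of a fixed integer
  polynomial eventually is too small, compared with $p^{s_i^i}$, to be divisible by it. Since
  $s_0^0 = 1$ even for $s_0 = 0$, the first exponent is $1$ and the sums are congruent to \<open>r\<close> modulo $p$.
\<close>
fun liouville :: "nat \<Rightarrow> nat \<Rightarrow> nat set \<Rightarrow> nat \<Rightarrow> nat" where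
  "liouville p r S 0 = r"
| "liouville p r S (Suc i) =
     liouville p r S i + (if i \<in> S then 2 else 1) * p ^ (liouville p r S i ^ i)"

locale liouville_number =
  fixes p r :: nat and S :: "nat set"
  assumes p: "prime p"
begin

abbreviation l where "l \<equiv> liouville p r S"

lemma liouville_less_Suc: "l i < l (Suc i)"
  using p by (simp add: prime_gt_0_nat)

lemma le_liouville: "i \<le> l i"
proof (induction i)
  case (Suc i)
  then show ?case using liouville_less_Suc[of i] by linarith
qed simp

lemma liouville_exponent_pos: "l i ^ i > 0"
  using le_liouville[of i] by (cases "i = 0") auto

lemma liouville_exponent_less_Suc: "l i ^ i < l (Suc i) ^ Suc i"
proof -
  have "p \<ge> 2" using p by (rule prime_ge_2_nat)
  moreover have "p \<le> p ^ (l i ^ i)"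
    using liouville_exponent_pos[of i] \<open>p \<ge> 2\<close> by (simp add: self_le_power)
  ultimately have "l (Suc i) \<ge> 2" by simp
  have "l i ^ i \<le> l (Suc i) ^ i"
    using liouville_less_Suc[of i] by (intro power_mono) auto
  also have "\<dots> < l (Suc i) ^ Suc i"
    using \<open>l (Suc i) \<ge> 2\<close> by (intro power_strict_increasing) auto
  finally show ?thesis .
qed

lemma liouville_exponent_mono: "i \<le> j \<Longrightarrow> l i ^ i \<le> l j ^ j"
  using lift_Suc_mono_le[of "\<lambda>i. l i ^ i" i j] liouville_exponent_less_Suc less_imp_le by blast

lemma le_liouville_exponent: "i \<le> l i ^ i"
proof (induction i)
  case (Suc i)
  then show ?case using liouville_exponent_less_Suc[of i] by linarith
qed simp

lemma liouville_congruent: "i \<le> j \<Longrightarrow> int p ^ (l i ^ i) dvd int (l j) - int (l i)"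
proof (induction j rule: dec_induct)
  case (step j)
  have "p ^ (l i ^ i) dvd (if j \<in> S then 2 else 1) * p ^ (l j ^ j)"
    using liouville_exponent_mono[OF step.hyps(1)] by (intro dvd_mult le_imp_power_dvd)
  then have "int p ^ (l i ^ i) dvd int ((if j \<in> S then 2 else 1) * p ^ (l j ^ j))"
    by (metis int_dvd_int_iff of_nat_power)
  from dvd_add[OF step.IH this] show ?case by (simp add: algebra_simps)
qed simp

lemma liouville_cong_start: "int p dvd int (l i) - int r"
  using liouville_congruent[of 0 i] by simp

sublocale padic_integer p "\<lambda>i. int (l i)"
proof
  fix k
  have "int p ^ k dvd int (l i) - int (l k)" if "i \<ge> k" for i
    using liouville_congruent[OF that] le_liouville_exponent[of k]
    by (meson dvd_trans le_imp_power_dvd)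
  then show "\<exists>N. \<forall>i\<ge>N. int p ^ k dvd int (l i) - int (l N)" by blast
qed (rule p)

text \<open>
  Liouville's argument. For large $i$ the integer $Q(s_i)$ is non-zero and smaller than
  $s_i^i < p^{s_i^i}$, while all later values of $Q$ are congruent to it modulo $p^{s_i^i}$.
\<close>
lemma liouville_transcendental:
  assumes "P \<noteq> 0" obtains k where "\<not> val_ge p (\<lambda>i. int (l i)) k P"
proof (rule ccontr)
  assume "\<not> thesis"
  then have all: "val_ge p (\<lambda>i. int (l i)) k P" for k using that by blast
  obtain d :: nat where d: "d > 0" "\<And>i. coeff (smult (of_nat d) P) i \<in> \<int>"
    using common_denominator[of P] by blast
  define Q where "Q = smult (of_nat d) P"
  have Q: "Q \<noteq> 0" "\<And>i. coeff Q i \<in> \<int>" using d assms unfolding Q_def by auto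
  have allQ: "val_ge p (\<lambda>i. int (l i)) k Q" for k
    unfolding Q_def
    using val_ge_smult[OF p_integral_of_int[OF p, of "int d"] all[of k]] by simp
  obtain R where R: "\<And>y :: nat. y \<ge> R \<Longrightarrow>
      poly Q (of_nat y) \<noteq> 0 \<and> \<bar>poly Q (of_nat y)\<bar> < of_nat y ^ Suc (degree Q)"
    using poly_eventually_small_nonzero[OF Q(1) lessI] by blast
  define i where "i = max R (Suc (degree Q))"
  define y e where "y = l i" and "e = l i ^ i"
  have "y \<ge> i" unfolding y_def by (rule le_liouville)
  obtain m where m: "poly Q (of_nat y) = of_int m"
    using poly_in_Ints[OF Q(2) Ints_of_nat[of y]] by (elim Ints_cases)
  have coeff_integral: "p_integral p (coeff Q j)" for j
    using Q(2)[of j] by (elim Ints_cases) (simp add: p)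
  have "\<forall>\<^sub>F j in sequentially. p_integral p (of_nat p powi (- int e) * poly Q (of_int (int (l j))))"
    using allQ[of "int e"] unfolding val_ge_def .
  then obtain j where j: "j \<ge> i"
    "p_integral p (of_nat p powi (- int e) * poly Q (of_int (int (l j))))"
    unfolding eventually_sequentially by (metis max.cobounded1 max.cobounded2)
  have "p_integral p ((poly Q (of_int (int (l j))) - poly Q (of_int (int y))) / of_nat p ^ e)"
    using p_integral_poly_diff[OF p coeff_integral] liouville_congruent[OF j(1)]
    unfolding y_def e_def by blast
  then have "p_integral p (of_nat p powi (- int e) * poly Q (of_int (int (l j)))
      - (poly Q (of_int (int (l j))) - poly Q (of_int (int y))) / of_nat p ^ e)"
    using p_integral_diff[OF p j(2)] by blast
  also have "of_nat p powi (- int e) * poly Q (of_int (int (l j)))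
      - (poly Q (of_int (int (l j))) - poly Q (of_int (int y))) / of_nat p ^ e
      = of_int m / of_nat p ^ e"
    using m by (simp add: power_int_minus divide_inverse algebra_simps)
  finally have "int p ^ e dvd m" using p_integral_divide_power_iff[OF p] by blast
  moreover have "m \<noteq> 0" using R[of y] m \<open>y \<ge> i\<close> unfolding i_def by auto
  ultimately have "int p ^ e \<le> \<bar>m\<bar>" by (metis dvd_abs_iff zdvd_imp_le zero_less_abs_iff)
  have "(of_int \<bar>m\<bar> :: rat) < of_int (int (y ^ Suc (degree Q)))"
    using R[of y] m \<open>y \<ge> i\<close> unfolding i_def by simp
  then have "\<bar>m\<bar> < int (y ^ Suc (degree Q))" by (simp only: of_int_less_iff)
  also have "y ^ Suc (degree Q) \<le> y ^ i"
    using \<open>y \<ge> i\<close> unfolding i_def by (intro power_increasing) auto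
  then have "int (y ^ Suc (degree Q)) \<le> int e" unfolding e_def y_def of_nat_le_iff .
  also have "int e < int (2 ^ e)" by (simp only: of_nat_less_iff less_exp)
  also have "\<dots> \<le> int p ^ e"
    using prime_ge_2_nat[OF p] by (simp add: power_mono flip: of_nat_power)
  finally show False using \<open>int p ^ e \<le> \<bar>m\<bar>\<close> by simp
qed

end

text \<open>
  At the first digit in which the sets differ the partial sums move apart by exactly one power of
  $p$, and the later exponents are strictly larger.
\<close>
lemma liouville_difference:
  assumes p: "prime p" and "S \<noteq> T"
  obtains e where "\<forall>\<^sub>F i in sequentially.
    \<exists>u. int (liouville p r S i) - int (liouville p r T i) = int p ^ e * u \<and> \<not> int p dvd u"
proof -
  define j where "j = (LEAST j. (j \<in> S) \<noteq> (j \<in> T))"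
  have j: "(j \<in> S) \<noteq> (j \<in> T)"
    using LeastI_ex[of "\<lambda>j. (j \<in> S) \<noteq> (j \<in> T)"] assms(2) unfolding j_def by blast
  have "(i \<in> S) = (i \<in> T)" if "i < j" for i
    using not_less_Least[of i "\<lambda>j. (j \<in> S) \<noteq> (j \<in> T)"] that unfolding j_def by simp
  then have same: "i \<le> j \<Longrightarrow> liouville p r S i = liouville p r T i" for i
    by (induction i) (simp_all add: Suc_le_eq)
  define e where "e = liouville p r S j ^ j"
  have eT: "e = liouville p r T j ^ j" unfolding e_def using same by simp
  have "\<exists>u. int (liouville p r S i) - int (liouville p r T i) = int p ^ e * u \<and> \<not> int p dvd u"
    if "i \<ge> Suc j" for i
  proof -
    \<comment> \<open>the difference of the digits at \<open>j\<close>, prime to \<open>p\<close> even if \<open>p = 2\<close>\<close>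
    define x where "x = (if j \<in> S then 1 else -1 :: int)"
    have *: "int (liouville p r S (Suc j)) - int (liouville p r T (Suc j)) = int p ^ e * x"
      using j same[of j] unfolding x_def e_def by (auto simp: algebra_simps)
    have **: "int p ^ Suc e dvd int (liouville p r U i) - int (liouville p r U (Suc j))"
      if "e = liouville p r U j ^ j" for U
    proof (rule dvd_trans)
      show "int p ^ Suc e dvd int p ^ (liouville p r U (Suc j) ^ Suc j)"
        using liouville_number.liouville_exponent_less_Suc[OF liouville_number.intro[OF p], of r U j] that
        by (intro le_imp_power_dvd) linarith
    qed (rule liouville_number.liouville_congruent[OF liouville_number.intro[OF p] \<open>i \<ge> Suc j\<close>])
    obtain a b where ab: "int (liouville p r S i) - int (liouville p r S (Suc j)) = int p ^ Suc e * a"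
      "int (liouville p r T i) - int (liouville p r T (Suc j)) = int p ^ Suc e * b"
      using **[OF e_def] **[OF eT] unfolding dvd_def by blast
    have "int (liouville p r S i) - int (liouville p r T i) = int p ^ e * (x + int p * (a - b))"
      using * ab by (simp add: algebra_simps)
    moreover have "\<not> int p dvd x + int p * (a - b)"
    proof
      assume "int p dvd x + int p * (a - b)"
      then have "int p dvd x" by (simp add: dvd_add_left_iff)
      then show False using p unfolding x_def by (auto split: if_splits)
    qed
    ultimately show ?thesis by blast
  qed
  then show ?thesis by (intro that[of e] eventually_sequentiallyI[of "Suc j"])
qed

definition root_floor :: "nat \<Rightarrow> nat \<Rightarrow> nat" where
  "root_floor n p = (GREATEST r. r ^ n \<le> p)"

lemma
  assumes "n > 0"
  shows root_floor_power_le: "root_floor n p ^ n \<le> p"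
    and le_root_floor: "R ^ n \<le> p \<Longrightarrow> R \<le> root_floor n p"
proof -
  have *: "r \<le> p" if "r ^ n \<le> p" for r
  proof (cases "r = 0")
    case False
    then show ?thesis using self_le_power[of r n] that assms by linarith
  qed simp
  show "root_floor n p ^ n \<le> p"
    unfolding root_floor_def
    using GreatestI_nat[of "\<lambda>r. r ^ n \<le> p" 0 p] * assms by (simp add: power_0_left)
  show "R ^ n \<le> p \<Longrightarrow> R \<le> root_floor n p"
    unfolding root_floor_def using Greatest_le_nat[of "\<lambda>r. r ^ n \<le> p" R p] * by blast
qed

section \<open>Groups of coefficient vectors\<close>

lemma lin_indep_subset: "lin_indep m G B \<Longrightarrow> B \<subseteq> carrier G"
  by (simp add: lin_indep_def)

lemma lin_indep_dvd:
  assumes "lin_indep m G B" "finite S" "S \<subseteq> B"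
    "finprod G (\<lambda>x. x [^]\<^bsub>G\<^esub> (c x :: int)) S = \<one>\<^bsub>G\<^esub>" "x \<in> S"
  shows "int m dvd c x"
proof -
  have "\<forall>x\<in>S. int m dvd c x"
    using assms(1) unfolding lin_indep_def using assms(2-4) by (elim conjE allE impE)
  then show ?thesis using assms(5) by (rule bspec)
qed

text \<open>
  The elements are the vectors themselves, functions on \<^typ>\<open>nat\<close> with finite support, while
  computations are made with the polynomials.
\<close>
definition coeff_group :: "rat poly set \<Rightarrow> (nat \<Rightarrow> rat) monoid" where
  "coeff_group A = \<lparr>carrier = coeff ` A, monoid.mult = \<lambda>x y i. x i + y i, one = \<lambda>_. 0\<rparr>"

lemma coeff_group_simps [simp]:
  "carrier (coeff_group A) = coeff ` A"
  "x \<otimes>\<^bsub>coeff_group A\<^esub> y = (\<lambda>i. x i + y i)"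
  "\<one>\<^bsub>coeff_group A\<^esub> = (\<lambda>_. 0)"
  by (simp_all add: coeff_group_def)

locale poly_subgroup =
  fixes A :: "rat poly set"
  assumes zero_closed: "0 \<in> A"
    and add_closed: "P \<in> A \<Longrightarrow> Q \<in> A \<Longrightarrow> P + Q \<in> A"
    and uminus_closed: "P \<in> A \<Longrightarrow> - P \<in> A"
begin

abbreviation G where "G \<equiv> coeff_group A"

lemma add_coeff: "(\<lambda>i. coeff P i + coeff Q i) = coeff (P + Q)"
  by (simp add: fun_eq_iff)

lemma comm_group_coeff_group: "comm_group G"
proof (rule comm_groupI)
  fix x assume "x \<in> carrier G"
  then obtain P where "P \<in> A" "x = coeff P" by auto
  then show "\<exists>y\<in>carrier G. y \<otimes>\<^bsub>G\<^esub> x = \<one>\<^bsub>G\<^esub>"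
    using uminus_closed by (intro bexI[of _ "coeff (- P)"]) auto
next
  show "\<one>\<^bsub>G\<^esub> \<in> carrier G"
    using zero_closed by (auto simp: image_iff fun_eq_iff intro!: bexI[of _ 0])
qed (auto simp: add_coeff add_closed algebra_simps)

sublocale comm_group "coeff_group A" by (rule comm_group_coeff_group)

lemma pow_nat_apply: "x [^]\<^bsub>G\<^esub> (k :: nat) = (\<lambda>i. of_nat k * x i)"
  by (induction k) (auto simp: algebra_simps)

lemma inv_apply: "x \<in> carrier G \<Longrightarrow> inv\<^bsub>G\<^esub> x = (\<lambda>i. - x i)"
proof (rule inv_equality)
  assume "x \<in> carrier G"
  then obtain P where P: "P \<in> A" "x = coeff P" by auto
  then have "(\<lambda>i. - x i) = coeff (- P)" by (simp add: fun_eq_iff)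
  then show "(\<lambda>i. - x i) \<in> carrier G" using uminus_closed[OF P(1)] by auto
qed auto

lemma pow_int_apply:
  assumes "x \<in> carrier G" shows "x [^]\<^bsub>G\<^esub> (k :: int) = (\<lambda>i. of_int k * x i)"
proof -
  have "x [^]\<^bsub>G\<^esub> nat (- k) \<in> carrier G" using assms by (rule nat_pow_closed)
  then show ?thesis
    using inv_apply[of "x [^]\<^bsub>G\<^esub> nat (- k)"]
    by (cases "k < 0") (auto simp: int_pow_def2 pow_nat_apply)
qed

lemma smult_closed: "P \<in> A \<Longrightarrow> smult (of_int k) P \<in> A"
proof -
  assume "P \<in> A"
  then have "coeff P [^]\<^bsub>G\<^esub> k \<in> carrier G" by (intro int_pow_closed) auto
  moreover have "coeff P [^]\<^bsub>G\<^esub> k = coeff (smult (of_int k) P)"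
    using \<open>P \<in> A\<close> by (subst pow_int_apply) (auto simp: fun_eq_iff)
  ultimately show ?thesis by (auto simp: coeff_inject)
qed

lemma smult_nat_closed: "P \<in> A \<Longrightarrow> smult (of_nat k) P \<in> A"
  using smult_closed[of P "int k"] by simp

lemma diff_closed: "P \<in> A \<Longrightarrow> Q \<in> A \<Longrightarrow> P - Q \<in> A"
  using add_closed[OF _ uminus_closed, of P Q] by simp

lemma finprod_pow_apply:
  assumes "finite S" "S \<subseteq> carrier G"
  shows "finprod G (\<lambda>x. x [^]\<^bsub>G\<^esub> (c x :: int)) S = (\<lambda>i. \<Sum>x\<in>S. of_int (c x) * x i)"
  using assms
proof (induction S rule: finite_induct)
  case empty
  then show ?case by (simp only: finprod_empty coeff_group_simps sum.empty)
next
  case (insert x S)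
  have x: "x \<in> carrier G" and S: "S \<subseteq> carrier G" using insert.prems by auto
  have "(\<lambda>x. x [^]\<^bsub>G\<^esub> c x) \<in> S \<rightarrow> carrier G"
    using S by (intro Pi_I int_pow_closed) (rule subsetD)
  then have "finprod G (\<lambda>x. x [^]\<^bsub>G\<^esub> c x) (insert x S) =
      x [^]\<^bsub>G\<^esub> c x \<otimes>\<^bsub>G\<^esub> finprod G (\<lambda>x. x [^]\<^bsub>G\<^esub> c x) S"
    using insert.hyps int_pow_closed[OF x] by (intro finprod_insert)
  then show ?case
    using insert.IH[OF S] insert.hyps pow_int_apply[OF x] by simp
qed

lemma torsion_free_coeff_group: "torsion_free G"
  unfolding torsion_free_def by (auto simp: pow_nat_apply fun_eq_iff)

lemma multiples_coeff_group: "multiples G k = coeff ` smult (of_nat k) ` A"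
proof -
  have "(\<lambda>i. of_nat k * coeff P i) = coeff (smult (of_nat k) P)" for P :: "rat poly"
    by (simp add: fun_eq_iff)
  then show ?thesis by (simp add: multiples_def pow_nat_apply image_image)
qed

text \<open>
  The coordinate vectors form a maximal independent set: every vector has a common denominator.
\<close>
lemma has_rank_coeff_group:
  assumes monom: "\<And>i. i < n \<Longrightarrow> monom 1 i \<in> A" and degree: "\<And>P. P \<in> A \<Longrightarrow> degree P < n"
  shows "has_rank G n"
proof -
  define f :: "nat \<Rightarrow> nat \<Rightarrow> rat" where "f i = coeff (monom 1 i)" for i
  have f: "f i k = (if k = i then 1 else 0)" for i k by (auto simp: f_def)
  have inj: "inj_on f UNIV" by (rule injI) (metis f zero_neq_one)
  define B where "B = f ` {..<n}"
  have B: "B \<subseteq> carrier G" using monom by (auto simp: B_def f_def)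
  have "lin_indep 0 G B"
    unfolding lin_indep_def
  proof (intro conjI allI impI ballI B)
    fix S c x
    assume S: "finite S" "S \<subseteq> B" and rel: "finprod G (\<lambda>x. x [^]\<^bsub>G\<^esub> (c x :: int)) S = \<one>\<^bsub>G\<^esub>"
      and "x \<in> S"
    then obtain i where i: "x = f i" unfolding B_def by blast
    have "(\<Sum>y\<in>S. of_int (c y) * y i) = (0 :: rat)"
      using finprod_pow_apply[OF S(1) subset_trans[OF S(2) B], of c] rel by (simp add: fun_eq_iff)
    moreover have "(\<Sum>y\<in>S - {x}. of_int (c y) * y i) = (0 :: rat)"
    proof (rule sum.neutral, rule ballI)
      fix y assume "y \<in> S - {x}"
      then obtain j where "y = f j" "y \<noteq> f i" using S(2) i unfolding B_def by blast
      then show "of_int (c y) * y i = (0 :: rat)" using f by auto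
    qed
    ultimately have "of_int (c x) * x i = (0 :: rat)"
      using sum.remove[OF S(1) \<open>x \<in> S\<close>, of "\<lambda>y. of_int (c y) * y i :: rat"] by simp
    then show "int 0 dvd c x" using i f by simp
  qed
  moreover have "B' = B" if B': "lin_indep 0 G B'" "B \<subseteq> B'" for B'
  proof (rule ccontr)
    assume "B' \<noteq> B"
    then obtain y where y: "y \<in> B'" "y \<notin> B" using B'(2) by blast
    then obtain P where P: "P \<in> A" "y = coeff P" using lin_indep_subset[OF B'(1)] by auto
    obtain d :: nat where d: "d > 0" "\<And>i. coeff (smult (of_nat d) P) i \<in> \<int>"
      using common_denominator[of P] by blast
    define c where "c z = (if z = y then - int d else \<lfloor>of_nat d * y (inv_into UNIV f z)\<rfloor>)" for z
    have c: "of_int (c (f i)) = of_nat d * y i" if "i < n" for i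
    proof -
      have "f i \<noteq> y" using that y(2) unfolding B_def by blast
      moreover have "of_nat d * y i \<in> \<int>" using d(2)[of i] P(2) by simp
      ultimately show ?thesis using inj by (simp add: c_def inv_f_f of_int_floor_cancel)
    qed
    \<comment> \<open>the relation \<open>d y = \<Sum> (d y i) f i\<close>, in which \<open>y\<close> has the coefficient \<open>- d\<close>\<close>
    have fin: "finite (insert y B)" "insert y B \<subseteq> B'" unfolding B_def using y(1) B'(2) B_def by auto
    have "(\<Sum>z\<in>insert y B. of_int (c z) * z k) = 0" for k
    proof -
      have "(\<Sum>z\<in>B. of_int (c z) * z k) = (\<Sum>i<n. of_int (c (f i)) * f i k)"
        unfolding B_def using inj by (subst sum.reindex) (auto intro: inj_on_subset)
      also have "\<dots> = (\<Sum>i<n. if k = i then of_nat d * y i else 0)"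
        by (intro sum.cong) (auto simp: f c)
      also have "\<dots> = of_nat d * y k"
        using degree[OF P(1)] P(2) by (simp add: coeff_eq_0)
      finally show ?thesis using y(2) by (simp add: c_def B_def)
    qed
    moreover have "insert y B \<subseteq> carrier G" using B P by auto
    ultimately have "finprod G (\<lambda>x. x [^]\<^bsub>G\<^esub> c x) (insert y B) = \<one>\<^bsub>G\<^esub>"
      using finprod_pow_apply[OF fin(1)] by simp
    then have "int 0 dvd c y" by (rule lin_indep_dvd[OF B'(1) fin]) simp
    then show False using d(1) by (simp add: c_def)
  qed
  moreover have "finite B" "card B = n"
    unfolding B_def using inj by (auto simp: card_image inj_on_subset)
  ultimately show ?thesis unfolding has_rank_def max_lin_indep_def by blast
qed

end

text \<open>
  If the generator itself is dependent, a power of it with exponent not divisible by \<open>m\<close> is trivial,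
  and with it the same power of every element, so that only the empty set is independent.
\<close>
lemma (in comm_group) cyclic_p_rank_le_1:
  assumes "m \<noteq> 1" and x: "x \<in> carrier G"
    and cyclic: "\<And>y. y \<in> carrier G \<Longrightarrow> \<exists>u :: int. y = x [^] u"
  shows "\<exists>r\<le>1. \<exists>B. max_lin_indep m G B \<and> finite B \<and> card B = r"
proof (cases "lin_indep m G {x}")
  case True
  have "B = {x}" if B: "lin_indep m G B" "{x} \<subseteq> B" for B
  proof (rule ccontr)
    assume "B \<noteq> {x}"
    then obtain y where y: "y \<in> B" "y \<noteq> x" using B(2) by blast
    have "y \<in> carrier G" using y(1) lin_indep_subset[OF B(1)] by blast
    then obtain u :: int where u: "y = x [^] u" using cyclic by blast
    define c where "c z = (if z = x then u else - 1)" for z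
    have "finprod G (\<lambda>z. z [^] c z) {x, y} = x [^] u \<otimes> y [^] (-1 :: int)"
      using x \<open>y \<in> carrier G\<close> y(2) by (simp add: c_def Pi_iff)
    also have "\<dots> = \<one>" using x u by (simp add: int_pow_neg)
    finally have "finprod G (\<lambda>z. z [^] c z) {x, y} = \<one>" .
    moreover have "finite {x, y}" "{x, y} \<subseteq> B" "y \<in> {x, y}" using B(2) y(1) by auto
    ultimately have "int m dvd c y" using lin_indep_dvd[OF B(1)] by blast
    then have "int m dvd - 1" using y(2) by (simp add: c_def)
    then show False using \<open>m \<noteq> 1\<close> by simp
  qed
  then have "max_lin_indep m G {x}" unfolding max_lin_indep_def using True by blast
  then show ?thesis by (intro exI[of _ 1]) auto
next
  case False
  then obtain S c where S: "S \<subseteq> {x}" "finprod G (\<lambda>z. z [^] (c z :: int)) S = \<one>"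
    "\<exists>z\<in>S. \<not> int m dvd c z"
    using x unfolding lin_indep_def by blast
  then have "S = {x}" by blast
  then have c: "x [^] c x = \<one>" "\<not> int m dvd c x" using S x by (auto simp: Pi_iff)
  have "B = {}" if B: "lin_indep m G B" for B
  proof (rule ccontr)
    assume "B \<noteq> {}"
    then obtain y where y: "y \<in> B" "y \<in> carrier G"
      using lin_indep_subset[OF B] by blast
    then obtain u :: int where u: "y = x [^] u" using cyclic by blast
    have "y [^] c x = (x [^] c x) [^] u"
      using x by (simp add: u int_pow_pow mult.commute)
    then have "finprod G (\<lambda>z. z [^] c x) {y} = \<one>"
      using y(2) c(1) by (simp add: Pi_iff)
    moreover have "finite {y}" "{y} \<subseteq> B" "y \<in> {y}" using y(1) by auto
    ultimately have "int m dvd c x"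
      using lin_indep_dvd[OF B, of "{y}" "\<lambda>_. c x"] by blast
    then show False using c(2) by simp
  qed
  moreover have "lin_indep m G {}" unfolding lin_indep_def by auto
  ultimately have "max_lin_indep m G {}" unfolding max_lin_indep_def by blast
  then show ?thesis by (intro exI[of _ 0]) auto
qed

section \<open>Multiplications as biadditive maps\<close>

text \<open>
  The easy half of the universal property of the tensor product: a homomorphism on the quotient of
  the free group restricts to a biadditive map on pairs, and it is trivial if this restriction is,
  since the pairs generate.
\<close>
lemma nil_group_if_no_biadditive:
  assumes "comm_group G"
    and no_mult: "\<And>b x y. \<lbrakk>\<And>x y. x \<in> carrier G \<Longrightarrow> y \<in> carrier G \<Longrightarrow> b x y \<in> carrier G;
        \<And>x x' y. \<lbrakk>x \<in> carrier G; x' \<in> carrier G; y \<in> carrier G\<rbrakk> \<Longrightarrow>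
          b (x \<otimes>\<^bsub>G\<^esub> x') y = b x y \<otimes>\<^bsub>G\<^esub> b x' y;
        \<And>x y y'. \<lbrakk>x \<in> carrier G; y \<in> carrier G; y' \<in> carrier G\<rbrakk> \<Longrightarrow>
          b x (y \<otimes>\<^bsub>G\<^esub> y') = b x y \<otimes>\<^bsub>G\<^esub> b x y';
        x \<in> carrier G; y \<in> carrier G\<rbrakk> \<Longrightarrow> b x y = \<one>\<^bsub>G\<^esub>"
  shows "nil_group G"
  unfolding nil_group_def
proof (intro conjI ballI assms(1))
  interpret G: comm_group G by (rule assms(1))
  define F where "F = free_Abelian_group (carrier G \<times> carrier G)"
  define N where "N = generate F (tensor_relations G G)"
  interpret F: comm_group F unfolding F_def by (rule abelian_free_Abelian_group)
  have R: "tensor_relations G G \<subseteq> carrier F"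
  proof
    fix c assume "c \<in> tensor_relations G G"
    then show "c \<in> carrier F"
      unfolding tensor_relations_def F_def carrier_free_Abelian_group_iff
      by (elim UnE CollectE exE conjE; hypsubst; intro order_trans[OF keys_diff] Un_least) auto
  qed
  have "subgroup N F" unfolding N_def by (rule F.generate_is_subgroup[OF R])
  then have normal: "N \<lhd> F" by (rule F.subgroup_imp_normal)
  fix \<mu> u
  assume "\<mu> \<in> hom (tensor_product G G) G" and "u \<in> carrier (tensor_product G G)"
  then have \<mu>: "\<mu> \<in> hom (F Mod N) G" and u: "u \<in> carrier (F Mod N)"
    by (simp_all add: tensor_product_def F_def N_def Let_def)
  define h where "h c = \<mu> (N #>\<^bsub>F\<^esub> c)" for c
  have h: "h \<in> hom F G"
    using hom_compose[OF normal.r_coset_hom_Mod[OF normal] \<mu>] unfolding h_def comp_def by simp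
  have h_closed: "h c \<in> carrier G" if "c \<in> carrier F" for c
    using h that by (auto simp: hom_def)
  have h_add: "h (c + d) = h c \<otimes>\<^bsub>G\<^esub> h d" if "c \<in> carrier F" "d \<in> carrier F" for c d
    using hom_mult[OF h that] by (simp add: F_def)
  have zero_F: "0 \<in> carrier F" by (simp add: F_def carrier_free_Abelian_group_iff)
  have h_0: "h 0 = \<one>\<^bsub>G\<^esub>"
    using hom_one[OF h F.group_axioms G.group_axioms] by (simp add: F_def)
  have diff_F: "c - d \<in> carrier F" if "c \<in> carrier F" "d \<in> carrier F" for c d
    using that keys_diff[of c d] by (auto simp: F_def carrier_free_Abelian_group_iff)
  have h_diff: "h (c - d) = h c \<otimes>\<^bsub>G\<^esub> inv\<^bsub>G\<^esub> h d" if "c \<in> carrier F" "d \<in> carrier F" for c d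
    using h_add[OF diff_F[OF that] that(2)] h_closed diff_F that
    by (simp add: G.inv_solve_right)
  have frag: "frag_of z \<in> carrier F" if "z \<in> carrier G \<times> carrier G" for z
    using that by (simp add: F_def carrier_free_Abelian_group_iff)
  have h_rel: "h c = \<one>\<^bsub>G\<^esub>" if "c \<in> tensor_relations G G" for c
  proof -
    have "c \<in> N" unfolding N_def by (rule generate.incl[OF that])
    then have "N #>\<^bsub>F\<^esub> c = \<one>\<^bsub>F Mod N\<^esub>"
      using subgroup.rcos_const[OF \<open>subgroup N F\<close> F.group_axioms] by (simp add: FactGroup_def)
    then show ?thesis
      using hom_one[OF \<mu> normal.factorgroup_is_group[OF normal] G.group_axioms] by (simp add: h_def)
  qed
  define b where "b x y = h (frag_of (x, y))" for x y
  have b_rel: "h (frag_of z - frag_of z' - frag_of z'') = \<one>\<^bsub>G\<^esub> \<Longrightarrow>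
      h (frag_of z) = h (frag_of z') \<otimes>\<^bsub>G\<^esub> h (frag_of z'')"
    if "z \<in> carrier G \<times> carrier G" "z' \<in> carrier G \<times> carrier G" "z'' \<in> carrier G \<times> carrier G" for z z' z''
    using h_add[of "frag_of z - frag_of z' - frag_of z''" "frag_of z' + frag_of z''"]
      h_add[of "frag_of z'" "frag_of z''"] frag[OF that(1)] frag[OF that(2)] frag[OF that(3)] diff_F
      h_closed F.m_closed[of "frag_of z'" "frag_of z''"]
    by (simp add: F_def algebra_simps)
  have b_one: "b x y = \<one>\<^bsub>G\<^esub>" if "x \<in> carrier G" "y \<in> carrier G" for x y
  proof (rule no_mult[OF _ _ _ that])
    show "b x y \<in> carrier G" if "x \<in> carrier G" "y \<in> carrier G" for x y
      using h_closed frag that by (simp add: b_def)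
    show "b (x \<otimes>\<^bsub>G\<^esub> x') y = b x y \<otimes>\<^bsub>G\<^esub> b x' y"
      if "x \<in> carrier G" "x' \<in> carrier G" "y \<in> carrier G" for x x' y
      unfolding b_def
    proof (rule b_rel[OF _ _ _ h_rel])
      show "frag_of (x \<otimes>\<^bsub>G\<^esub> x', y) - frag_of (x, y) - frag_of (x', y) \<in> tensor_relations G G"
        unfolding tensor_relations_def using that by blast
    qed (use that in auto)
    show "b x (y \<otimes>\<^bsub>G\<^esub> y') = b x y \<otimes>\<^bsub>G\<^esub> b x y'"
      if "x \<in> carrier G" "y \<in> carrier G" "y' \<in> carrier G" for x y y'
      unfolding b_def
    proof (rule b_rel[OF _ _ _ h_rel])
      show "frag_of (x, y \<otimes>\<^bsub>G\<^esub> y') - frag_of (x, y) - frag_of (x, y') \<in> tensor_relations G G"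
        unfolding tensor_relations_def using that by blast
    qed (use that in auto)
  qed
  have "c \<in> carrier F \<and> h c = \<one>\<^bsub>G\<^esub>" if "c \<in> carrier F" for c
  proof -
    have "Poly_Mapping.keys c \<subseteq> carrier G \<times> carrier G"
      using that by (simp add: F_def carrier_free_Abelian_group_iff)
    then show ?thesis
    proof (induction c rule: frag_induction)
      case (diff a b)
      then show ?case using diff_F h_diff by simp
    qed (use zero_F h_0 frag b_one in \<open>auto simp: b_def\<close>)
  qed
  moreover obtain c where "c \<in> carrier F" "u = N #>\<^bsub>F\<^esub> c"
    using u by (auto simp: FactGroup_def RCOSETS_def)
  ultimately show "\<mu> u = \<one>\<^bsub>G\<^esub>" unfolding h_def by simp
qed

section \<open>Lattices defined by transcendental points\<close>

definition padic_lattice :: "nat \<Rightarrow> (nat \<Rightarrow> enat) \<Rightarrow> (nat \<Rightarrow> nat \<Rightarrow> int) \<Rightarrow> rat poly set" where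
  "padic_lattice n \<chi> s = {P. degree P < n \<and>
     (\<forall>p k. prime p \<longrightarrow> \<chi> p = enat k \<longrightarrow> val_ge p (s p) (- int k) P)}"

text \<open>
  The last-but-one assumption is what makes all elements have the same type, and the last one says
  that the type is not that of the divisible groups.
\<close>
locale transcendental_lattice =
  fixes n :: nat and \<chi> :: "nat \<Rightarrow> enat" and s :: "nat \<Rightarrow> nat \<Rightarrow> int"
  assumes n_gt_1: "n > 1"
    and padic: "\<And>p. prime p \<Longrightarrow> padic_integer p (s p)"
    and separated: "\<And>p P. prime p \<Longrightarrow> P \<noteq> 0 \<Longrightarrow> \<exists>k. \<not> val_ge p (s p) k P"
    and almost_unit: "\<And>P. P \<noteq> 0 \<Longrightarrow> degree P < n \<Longrightarrow>
      finite {p. prime p \<and> \<not> (val_ge p (s p) 0 P \<and> \<not> val_ge p (s p) 1 P)}"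
    and finite_place: "\<exists>p. prime p \<and> \<chi> p \<noteq> \<infinity>"
begin

abbreviation L where "L \<equiv> padic_lattice n \<chi> s"

lemma lattice_degree: "P \<in> L \<Longrightarrow> degree P < n"
  by (simp add: padic_lattice_def)

lemma lattice_val_ge: "P \<in> L \<Longrightarrow> prime p \<Longrightarrow> \<chi> p = enat k \<Longrightarrow> val_ge p (s p) (- int k) P"
  by (simp add: padic_lattice_def)

lemma latticeI:
  assumes "degree P < n" "\<And>p k. prime p \<Longrightarrow> \<chi> p = enat k \<Longrightarrow> val_ge p (s p) (- int k) P"
  shows "P \<in> L"
  using assms by (simp add: padic_lattice_def)

sublocale poly_subgroup L
proof
  show "0 \<in> L"
    using n_gt_1 by (auto intro!: latticeI padic_integer.val_ge_0 padic)
  show "P + Q \<in> L" if "P \<in> L" "Q \<in> L" for P Q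
    using that degree_add_le_max[of P Q]
    by (intro latticeI padic_integer.val_ge_add[OF padic]) (auto simp: padic_lattice_def)
  show "- P \<in> L" if "P \<in> L" for P
    using that by (intro latticeI padic_integer.val_ge_uminus[OF padic]) (auto simp: padic_lattice_def)
qed

lemma integer_poly_in_lattice:
  assumes "degree P < n" "\<And>i. coeff P i \<in> \<int>"
  shows "P \<in> L"
proof (rule latticeI)
  fix p k assume p: "prime p" "\<chi> p = enat k"
  have "p_integral p (coeff P i)" for i
    using assms(2)[of i] by (elim Ints_cases) (simp add: p)
  then show "val_ge p (s p) (- int k) P"
    using padic_integer.val_ge_mono[OF padic[OF p(1)] padic_integer.val_ge_integral[OF padic[OF p(1)]]]
    by simp
qed (rule assms(1))

lemma one_in_lattice: "1 \<in> L"
  using n_gt_1 by (intro integer_poly_in_lattice) auto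

lemma const_in_lattice: "[:of_int m:] \<in> L"
  using n_gt_1 by (intro integer_poly_in_lattice) (auto simp: coeff_pCons split: nat.splits)

text \<open>
  Division by $p^j$ changes the valuation at no prime other than $p$, so the condition at $p$ alone
  decides divisibility. Thus the valuation at $p$ is the $p$-height up to the constant $\chi_p$.
\<close>
lemma divisible_by_power_iff:
  assumes "P \<in> L" "prime p"
  shows "(\<exists>Q\<in>L. P = smult (of_nat p ^ j) Q) \<longleftrightarrow>
    (\<forall>k. \<chi> p = enat k \<longrightarrow> val_ge p (s p) (int j - int k) P)"
proof (intro iffI allI impI)
  interpret p: padic_integer p "s p" by (rule padic[OF assms(2)])
  show "val_ge p (s p) (int j - int k) P"
    if "\<exists>Q\<in>L. P = smult (of_nat p ^ j) Q" "\<chi> p = enat k" for k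
    using that lattice_val_ge[OF _ assms(2)] by (auto simp: p.val_ge_smult_power)
next
  interpret p: padic_integer p "s p" by (rule padic[OF assms(2)])
  assume *: "\<forall>k. \<chi> p = enat k \<longrightarrow> val_ge p (s p) (int j - int k) P"
  define Q where "Q = smult (1 / of_nat p ^ j) P"
  have PQ: "P = smult (of_nat p ^ j) Q" unfolding Q_def using p.p_nz by simp
  have "Q \<in> L"
  proof (rule latticeI)
    show "degree Q < n" unfolding Q_def using lattice_degree[OF assms(1)] by simp
    fix q k assume q: "prime q" "\<chi> q = enat k"
    interpret q: padic_integer q "s q" by (rule padic[OF q(1)])
    show "val_ge q (s q) (- int k) Q"
    proof (cases "q = p")
      case True
      have "val_ge p (s p) (int j - int k) (smult (of_nat p ^ j) Q)"
        using * q(2) PQ True by simp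
      then show ?thesis using True by (simp add: p.val_ge_smult_power)
    next
      case False
      have "\<not> int q dvd int p ^ j"
        using False q(1) assms(2) by (metis prime_dvd_power prime_nat_int_transfer primes_dvd_imp_eq int_dvd_int_iff)
      then have "val_ge q (s q) (- int k) (smult (of_int (int p ^ j)) Q)
          \<longleftrightarrow> val_ge q (s q) (- int k) Q"
        by (rule q.val_ge_smult_unit)
      moreover have "smult (of_int (int p ^ j)) Q = P" using PQ by simp
      ultimately show ?thesis using lattice_val_ge[OF assms(1) q] by simp
    qed
  qed
  then show "\<exists>Q\<in>L. P = smult (of_nat p ^ j) Q" using PQ by blast
qed

lemma zero_if_all_val_ge:
  assumes "prime p" "\<And>j. val_ge p (s p) (int j - c) P"
  shows "P = 0"
proof (rule ccontr)
  assume "P \<noteq> 0"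
  then obtain k where "\<not> val_ge p (s p) k P" using separated[OF assms(1)] by blast
  moreover have "val_ge p (s p) k P"
    using padic_integer.val_ge_mono[OF padic[OF assms(1)] assms(2)[of "nat (k + c)"]] by simp
  ultimately show False by blast
qed

lemma zero_if_infinitely_divisible:
  assumes "P \<in> L" "prime p" "\<chi> p \<noteq> \<infinity>" "\<And>j. \<exists>Q\<in>L. P = smult (of_nat p ^ j) Q"
  shows "P = 0"
proof -
  obtain k where k: "\<chi> p = enat k" using assms(3) by auto
  then have "val_ge p (s p) (int j - int k) P" for j
    using assms(4)[of j] divisible_by_power_iff[OF assms(1,2)] by blast
  then show ?thesis by (rule zero_if_all_val_ge[OF assms(2)])
qed

lemma has_rank_lattice: "has_rank G n"
proof (rule has_rank_coeff_group)
  fix i assume "i < n"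
  then show "monom 1 i \<in> L"
    by (intro integer_poly_in_lattice) (auto simp: degree_monom_eq)
qed (rule lattice_degree)

lemma reduced_lattice: "reduced G"
  unfolding reduced_def
proof (intro allI impI)
  fix D assume D: "subgroup D G" "divisible (G\<lparr>carrier := D\<rparr>)"
  obtain p where p: "prime p" "\<chi> p \<noteq> \<infinity>" using finite_place by blast
  have "x = \<one>\<^bsub>G\<^esub>" if x: "x \<in> D" for x
  proof -
    have "D \<subseteq> carrier G" by (rule subgroup.subset[OF D(1)])
    then obtain P where P: "P \<in> L" "x = coeff P" using x by auto
    have "\<exists>Q\<in>L. P = smult (of_nat p ^ j) Q" for j
    proof -
      have "p ^ j > 0" using prime_gt_0_nat[OF p(1)] by simp
      then obtain y where y: "y \<in> D" "y [^]\<^bsub>G\<^esub> (p ^ j) = x"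
        using D(2) x unfolding divisible_def nat_pow_consistent[of _ _ D, symmetric]
        by (metis partial_object.select_convs(1) partial_object.surjective partial_object.update_convs(1))
      then obtain Q where "Q \<in> L" "y = coeff Q" using \<open>D \<subseteq> carrier G\<close> by auto
      then show ?thesis
        using y(2) P(2) by (intro bexI[of _ Q]) (auto simp: pow_nat_apply poly_eq_iff fun_eq_iff)
    qed
    then have "P = 0" using zero_if_infinitely_divisible[OF P(1) p] by blast
    then show ?thesis using P(2) by (simp add: fun_eq_iff)
  qed
  then show "D = {\<one>\<^bsub>G\<^esub>}" using subgroup.one_closed[OF D(1)] by blast
qed

text \<open>
  Scaled by $p^{\chi_p}$, the values of $P_0$ and $P$ have residues $m$ and $l$ modulo $p$, and
  $m \neq 0$ as $P_0$ is not divisible by $p$. Then $u = l / m$ modulo $p$ works.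
\<close>
lemma residue_line:
  assumes p: "prime p" and P0: "P0 \<in> L" "\<not> (\<exists>R\<in>L. P0 = smult (of_nat p) R)" and P: "P \<in> L"
  obtains u R where "R \<in> L" "P = smult (of_int u) P0 + smult (of_nat p) R"
proof -
  interpret p: padic_integer p "s p" by (rule padic[OF p])
  obtain k where k: "\<chi> p = enat k" "\<not> val_ge p (s p) (1 - int k) P0"
    using divisible_by_power_iff[OF P0(1) p, of 1] P0(2) by auto
  have integral: "val_ge p (s p) 0 (smult (of_nat p ^ k) Q)" if "Q \<in> L" for Q
    using lattice_val_ge[OF that p k(1)] by (simp add: p.val_ge_smult_power)
  obtain m where m: "val_ge p (s p) 1 (smult (of_nat p ^ k) P0 - [:of_int m:])"
    using p.val_ge_approx[OF integral[OF P0(1)], of 1] by auto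
  obtain l where l: "val_ge p (s p) 1 (smult (of_nat p ^ k) P - [:of_int l:])"
    using p.val_ge_approx[OF integral[OF P], of 1] by auto
  have "\<not> int p dvd m"
  proof
    assume "int p dvd m"
    then have "val_ge p (s p) 1 [:of_int m:]" using p.val_ge_const[of 1 m] by simp
    from p.val_ge_add[OF m this] have "val_ge p (s p) 1 (smult (of_nat p ^ k) P0)" by simp
    then show False using k(2) by (simp add: p.val_ge_smult_power)
  qed
  then have "coprime m (int p)"
    using prime_imp_coprime[of "int p" m] p by (simp add: coprime_commute)
  then obtain c z where cz: "m * c + int p * z = 1"
    by (metis bezout_int mult.commute coprime_imp_gcd_eq_1)
  define u where "u = l * c"
  have "l - u * m = l * (1 - m * c)" by (simp add: u_def algebra_simps)
  also have "1 - m * c = int p * z" using cz by simp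
  finally have const: "val_ge p (s p) 1 [:of_int (l - u * m):]"
    using p.val_ge_const[of 1 "l - u * m"] by simp
  have "val_ge p (s p) 1 (smult (of_int u) (smult (of_nat p ^ k) P0 - [:of_int m:]))"
    using p.val_ge_smult[OF p_integral_of_int[OF p] m] .
  from p.val_ge_add[OF p.val_ge_diff[OF l this] const]
  have "val_ge p (s p) 1 ((smult (of_nat p ^ k) P - [:of_int l:])
      - smult (of_int u) (smult (of_nat p ^ k) P0 - [:of_int m:]) + [:of_int (l - u * m):])" .
  also have "(smult (of_nat p ^ k) P - [:of_int l:])
      - smult (of_int u) (smult (of_nat p ^ k) P0 - [:of_int m:]) + [:of_int (l - u * m):]
      = smult (of_nat p ^ k) (P - smult (of_int u) P0)"
    by (simp add: poly_eq_iff coeff_pCons algebra_simps split: nat.splits)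
  finally have "val_ge p (s p) (1 - int k) (P - smult (of_int u) P0)"
    by (simp add: p.val_ge_smult_power)
  moreover have "P - smult (of_int u) P0 \<in> L" using P P0(1) diff_closed smult_closed by blast
  ultimately obtain R where "R \<in> L" "P - smult (of_int u) P0 = smult (of_nat p) R"
    using divisible_by_power_iff[of _ p 1] p k(1) by auto
  then show ?thesis using that[of R u] by (simp add: algebra_simps)
qed

lemma p_rank_le_1:
  assumes p: "prime p" shows "\<exists>r\<le>1. has_p_rank p G r"
proof -
  define N where "N = multiples G p"
  have N: "N = coeff ` smult (of_nat p) ` L" by (simp add: N_def multiples_coeff_group)
  have "subgroup N G"
  proof (rule subgroupI)
    show "N \<subseteq> carrier G" unfolding N using smult_nat_closed by auto
    show "N \<noteq> {}" unfolding N using zero_closed by blast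
    show "inv\<^bsub>G\<^esub> a \<in> N" if a: "a \<in> N" for a
    proof -
      obtain P where P: "P \<in> L" "a = coeff (smult (of_nat p) P)" using a unfolding N by auto
      then have "a \<in> carrier G" using smult_nat_closed[OF P(1)] by simp
      from inv_apply[OF this] have "inv\<^bsub>G\<^esub> a = coeff (smult (of_nat p) (- P))"
        unfolding P(2) by (simp add: fun_eq_iff)
      then show ?thesis unfolding N using uminus_closed[OF P(1)] by blast
    qed
    show "a \<otimes>\<^bsub>G\<^esub> b \<in> N" if ab: "a \<in> N" "b \<in> N" for a b
    proof -
      obtain P Q where P: "P \<in> L" "a = coeff (smult (of_nat p) P)"
        and Q: "Q \<in> L" "b = coeff (smult (of_nat p) Q)" using ab unfolding N by auto
      then have "a \<otimes>\<^bsub>G\<^esub> b = coeff (smult (of_nat p) (P + Q))"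
        by (simp add: fun_eq_iff algebra_simps)
      then show ?thesis unfolding N using add_closed[OF P(1) Q(1)] by blast
    qed
  qed
  then have normal: "N \<lhd> G" by (rule subgroup_imp_normal)
  interpret Q: comm_group "G Mod N" by (rule abelian_FactGroup[OF \<open>subgroup N G\<close>])
  define h where "h x = N #>\<^bsub>G\<^esub> x" for x
  interpret h: group_hom G "G Mod N" h
    unfolding h_def using normal.r_coset_hom_Mod[OF normal]
    by (simp add: group_hom_def group_hom_axioms_def is_group Q.is_group)
  have kernel: "h (coeff (smult (of_nat p) R)) = \<one>\<^bsub>G Mod N\<^esub>" if "R \<in> L" for R
    unfolding h_def
    using subgroup.rcos_const[OF \<open>subgroup N G\<close> is_group] that
    by (simp add: FactGroup_def N)
  have surj: "\<exists>P\<in>L. y = h (coeff P)" if "y \<in> carrier (G Mod N)" for y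
    using that unfolding h_def by (auto simp: FactGroup_def RCOSETS_def)
  have "\<exists>x\<in>carrier (G Mod N). \<forall>y\<in>carrier (G Mod N). \<exists>u::int. y = x [^]\<^bsub>G Mod N\<^esub> u"
  proof (cases "\<forall>P\<in>L. \<exists>R\<in>L. P = smult (of_nat p) R")
    case True
    have "y = \<one>\<^bsub>G Mod N\<^esub> [^]\<^bsub>G Mod N\<^esub> (0 :: int)" if "y \<in> carrier (G Mod N)" for y
      using surj[OF that] True kernel by force
    then show ?thesis by blast
  next
    case False
    then obtain P0 where P0: "P0 \<in> L" "\<not> (\<exists>R\<in>L. P0 = smult (of_nat p) R)" by blast
    have x: "h (coeff P0) \<in> carrier (G Mod N)" using P0(1) by (intro h.hom_closed) auto
    have "\<exists>u::int. y = h (coeff P0) [^]\<^bsub>G Mod N\<^esub> u" if y: "y \<in> carrier (G Mod N)" for y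
    proof -
      obtain P where P: "P \<in> L" "y = h (coeff P)" using surj[OF y] by blast
      obtain u R where R: "R \<in> L" "P = smult (of_int u) P0 + smult (of_nat p) R"
        using residue_line[OF p P0 P(1)] .
      have P0G: "coeff P0 \<in> carrier G" using P0(1) by simp
      have "coeff P = (coeff P0 [^]\<^bsub>G\<^esub> u) \<otimes>\<^bsub>G\<^esub> coeff (smult (of_nat p) R)"
        using R(2) pow_int_apply[OF P0G] by (simp add: fun_eq_iff)
      moreover have "coeff (smult (of_nat p) R) \<in> carrier G" using smult_nat_closed[OF R(1)] by simp
      ultimately have "y = h (coeff P0 [^]\<^bsub>G\<^esub> u) \<otimes>\<^bsub>G Mod N\<^esub> \<one>\<^bsub>G Mod N\<^esub>"
        using P(2) h.hom_mult[OF int_pow_closed[OF P0G]] kernel[OF R(1)] by metis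
      also have "h (coeff P0 [^]\<^bsub>G\<^esub> u) = h (coeff P0) [^]\<^bsub>G Mod N\<^esub> u"
        using h.hom_int_pow[OF P0G] .
      also have "h (coeff P0) [^]\<^bsub>G Mod N\<^esub> u \<otimes>\<^bsub>G Mod N\<^esub> \<one>\<^bsub>G Mod N\<^esub>
          = h (coeff P0) [^]\<^bsub>G Mod N\<^esub> u"
        by (rule Q.r_one[OF Q.int_pow_closed[OF x]])
      finally show ?thesis by blast
    qed
    then show ?thesis using x by blast
  qed
  then obtain x where "x \<in> carrier (G Mod N)"
    "\<And>y. y \<in> carrier (G Mod N) \<Longrightarrow> \<exists>u::int. y = x [^]\<^bsub>G Mod N\<^esub> u" by blast
  moreover have "p \<noteq> 1" using p by auto
  ultimately show ?thesis
    using Q.cyclic_p_rank_le_1 unfolding has_p_rank_def N_def by blast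
qed

lemma p_height_lattice:
  assumes "P \<in> L"
  shows "p_height p G (coeff P) = Sup {enat j | j. \<exists>Q\<in>L. P = smult (of_nat p ^ j) Q}"
proof -
  have "(\<exists>x\<in>carrier G. x [^]\<^bsub>G\<^esub> (p ^ j) = coeff P) \<longleftrightarrow> (\<exists>Q\<in>L. P = smult (of_nat p ^ j) Q)" for j
    by (auto simp: pow_nat_apply poly_eq_iff fun_eq_iff Bex_def eq_commute)
  then show ?thesis unfolding p_height_def by simp
qed

text \<open>
  At a prime with $\chi_p = \infty$ no condition is imposed, so division by $p$ never leaves the group.
\<close>
lemma p_height_infinite:
  assumes "P \<in> L" "prime p" "\<chi> p = \<infinity>"
  shows "p_height p G (coeff P) = \<infinity>"
proof -
  have "\<exists>Q\<in>L. P = smult (of_nat p ^ j) Q" for j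
    using divisible_by_power_iff[OF assms(1,2)] assms(3) by simp
  then have "p_height p G (coeff P) = Sup (range enat)"
    unfolding p_height_lattice[OF assms(1)] by (simp add: full_SetCompr_eq)
  moreover have "infinite (range enat)" by (simp add: finite_image_iff inj_on_def)
  ultimately show ?thesis unfolding Sup_enat_def by (auto simp del: finite_image_iff)
qed

lemma p_height_finite:
  assumes "P \<in> L" "prime p" "\<chi> p = enat k" "P \<noteq> 0"
  shows "p_height p G (coeff P) \<noteq> \<infinity>"
proof -
  obtain j where j: "\<not> (\<exists>Q\<in>L. P = smult (of_nat p ^ j) Q)"
    using zero_if_infinitely_divisible[OF assms(1,2)] assms(3,4) by auto
  have "p_height p G (coeff P) \<le> enat j"
    unfolding p_height_lattice[OF assms(1)]
  proof (rule Sup_least)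
    fix h assume "h \<in> {enat j | j. \<exists>Q\<in>L. P = smult (of_nat p ^ j) Q}"
    then obtain i where i: "h = enat i" "\<exists>Q\<in>L. P = smult (of_nat p ^ i) Q" by blast
    then have "val_ge p (s p) (int i - int k) P"
      using divisible_by_power_iff[OF assms(1,2)] assms(3) by blast
    moreover have "\<not> val_ge p (s p) (int j - int k) P"
      using divisible_by_power_iff[OF assms(1,2)] assms(3) j by auto
    ultimately have "i < j"
      using padic_integer.val_ge_mono[OF padic[OF assms(2)], of "int i - int k" P "int j - int k"]
      by fastforce
    then show "h \<le> enat j" using i(1) by simp
  qed
  then show ?thesis by (auto dest: enat_ile)
qed

lemma p_height_unit:
  assumes "P \<in> L" "prime p" "\<chi> p = enat k" "val_ge p (s p) 0 P" "\<not> val_ge p (s p) 1 P"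
  shows "p_height p G (coeff P) = \<chi> p"
proof -
  have "(\<exists>Q\<in>L. P = smult (of_nat p ^ j) Q) \<longleftrightarrow> j \<le> k" for j
  proof
    assume "\<exists>Q\<in>L. P = smult (of_nat p ^ j) Q"
    then have "val_ge p (s p) (int j - int k) P"
      using divisible_by_power_iff[OF assms(1,2)] assms(3) by blast
    then have "\<not> 1 \<le> int j - int k"
      using padic_integer.val_ge_mono[OF padic[OF assms(2)]] assms(5) by blast
    then show "j \<le> k" by simp
  next
    assume "j \<le> k"
    then have "val_ge p (s p) (int j - int k) P"
      using padic_integer.val_ge_mono[OF padic[OF assms(2)] assms(4)] by simp
    then show "\<exists>Q\<in>L. P = smult (of_nat p ^ j) Q"
      using divisible_by_power_iff[OF assms(1,2)] assms(3) by simp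
  qed
  then have "p_height p G (coeff P) = Sup {enat j | j. j \<le> k}"
    unfolding p_height_lattice[OF assms(1)] by simp
  also have "\<dots> = enat k" by (rule Sup_eqI) auto
  finally show ?thesis using assms(3) by simp
qed

lemma elem_type_lattice:
  assumes "x \<in> carrier G - {\<one>\<^bsub>G\<^esub>}"
  shows "elem_type G x = type_of_char \<chi>"
proof -
  obtain P where P: "P \<in> L" "x = coeff P" "P \<noteq> 0" using assms by fastforce
  have "{p. prime p \<and> \<chi> p \<noteq> p_height p G x} \<subseteq>
      {p. prime p \<and> \<not> (val_ge p (s p) 0 P \<and> \<not> val_ge p (s p) 1 P)}"
    using p_height_infinite[OF P(1)] p_height_unit[OF P(1)] P(2) by (auto simp: not_infinity_eq)
       (metis not_infinity_eq)+
  then have "finite {p. prime p \<and> \<chi> p \<noteq> p_height p G x}"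
    using almost_unit[OF P(3) lattice_degree[OF P(1)]] finite_subset by blast
  moreover have "\<chi> p \<noteq> \<infinity> \<and> p_height p G x \<noteq> \<infinity>" if "prime p" "\<chi> p \<noteq> p_height p G x" for p
    using p_height_infinite[OF P(1) that(1)] p_height_finite[OF P(1) that(1) _ P(3)] that(2) P(2)
    by (cases "\<chi> p") auto
  ultimately have "(\<chi>, \<lambda>p. p_height p G x) \<in> char_rel" unfolding char_rel_def by blast
  then show ?thesis
    unfolding elem_type_def type_of_char_def using equiv_class_eq[OF equiv_char_rel] by metis
qed

lemma group_type_lattice: "group_type G = type_of_char \<chi>"
proof -
  have "coeff 1 \<in> carrier G - {\<one>\<^bsub>G\<^esub>}"
    using one_in_lattice by (auto simp: fun_eq_iff intro!: exI[of _ 0])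
  then show ?thesis
    unfolding group_type_def using elem_type_lattice by (intro the_equality) blast+
qed

lemma MH_lattice: "MH G"
  unfolding MH_def Murley_def homogeneous_def
  using comm_group_coeff_group reduced_lattice torsion_free_coeff_group has_rank_lattice
    p_rank_le_1 elem_type_lattice by metis

end

section \<open>Multiplications on the lattices\<close>

lemma additive_smult:
  fixes f :: "rat poly \<Rightarrow> rat poly"
  assumes "poly_subgroup A" and add: "\<And>P Q. P \<in> A \<Longrightarrow> Q \<in> A \<Longrightarrow> f (P + Q) = f P + f Q"
    and "P \<in> A"
  shows "f (smult (of_int k) P) = smult (of_int k) (f P)"
proof -
  interpret poly_subgroup A by (rule assms(1))
  have f0: "f 0 = 0" using add[OF zero_closed zero_closed] by simp
  have nat: "f (smult (of_nat m) Q) = smult (of_nat m) (f Q)" if "Q \<in> A" for m Q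
  proof (induction m)
    case (Suc m)
    then show ?case
      using add[OF that smult_nat_closed[OF that, of m]] by (simp add: smult_add_left)
  qed (simp add: f0)
  have neg: "f (- P) = - f P"
    using add[OF assms(3) uminus_closed[OF assms(3)]] f0 by (simp add: eq_neg_iff_add_eq_0 add.commute)
  show ?thesis
  proof (cases "k \<ge> 0")
    case True
    then show ?thesis using nat[OF assms(3), of "nat k"] by (simp add: of_nat_nat)
  next
    case False
    then have "smult (of_int k) Q = smult (of_nat (nat (- k))) (- Q)" for Q :: "rat poly"
      by (simp add: of_nat_nat)
    then show ?thesis using nat[OF uminus_closed[OF assms(3)], of "nat (- k)"] neg by metis
  qed
qed

context transcendental_lattice
begin

text \<open>
  Write $P = m + p^j P'$ and $Q = l + p^j Q'$ with integers $m$ and $l$ and with $P'$ and $Q'$ in the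
  group. Both sides equal $m l \beta(1, 1)$ up to $p^j$ times terms whose valuations are bounded
  below independently of $j$. So the difference has infinite valuation, and by transcendence of the
  point it is zero as a polynomial.
\<close>
lemma biadditive_eq_mult:
  assumes closed: "\<And>P Q. P \<in> L \<Longrightarrow> Q \<in> L \<Longrightarrow> \<beta> P Q \<in> L"
    and add1: "\<And>P P' Q. P \<in> L \<Longrightarrow> P' \<in> L \<Longrightarrow> Q \<in> L \<Longrightarrow> \<beta> (P + P') Q = \<beta> P Q + \<beta> P' Q"
    and add2: "\<And>P Q Q'. P \<in> L \<Longrightarrow> Q \<in> L \<Longrightarrow> Q' \<in> L \<Longrightarrow> \<beta> P (Q + Q') = \<beta> P Q + \<beta> P Q'"
    and p: "prime p" "\<chi> p = enat k"
    and P: "P \<in> L" "val_ge p (s p) 0 P" and Q: "Q \<in> L" "val_ge p (s p) 0 Q"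
  shows "\<beta> P Q = \<beta> 1 1 * P * Q"
proof -
  interpret p: padic_integer p "s p" by (rule padic[OF p(1)])
  note smult1 = additive_smult[OF poly_subgroup_axioms, of "\<lambda>P. \<beta> P Q" for Q, OF add1]
  note smult2 = additive_smult[OF poly_subgroup_axioms, of "\<beta> P" for P, OF add2]
  have pow: "smult (of_nat p ^ j) R \<in> L" if "R \<in> L" for j R
    using smult_nat_closed[OF that, of "p ^ j"] by simp
  have pow1: "\<beta> (smult (of_nat p ^ j) R) R' = smult (of_nat p ^ j) (\<beta> R R')"
    if "R \<in> L" "R' \<in> L" for j R R'
    using smult1[OF _ _ that(2) that(1), of "int p ^ j"] that(2) by simp
  have pow2: "\<beta> R (smult (of_nat p ^ j) R') = smult (of_nat p ^ j) (\<beta> R R')"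
    if "R \<in> L" "R' \<in> L" for j R R'
    using smult2[OF that(1) _ _ that(2), of "int p ^ j"] that(1) by simp
  define D where "D = \<beta> P Q - \<beta> 1 1 * P * Q"
  have approx: "\<exists>m. \<exists>R'\<in>L. R = smult (of_int m) 1 + smult (of_nat p ^ j) R'"
    if R: "R \<in> L" "val_ge p (s p) 0 R" for R j
  proof -
    obtain m where m: "val_ge p (s p) (int j) (R - [:of_int m:])"
      using p.val_ge_approx[OF R(2)] .
    then have "val_ge p (s p) (int j - int k) (R - [:of_int m:])"
      by (rule p.val_ge_mono) simp
    moreover have "R - [:of_int m:] \<in> L" using R(1) const_in_lattice diff_closed by blast
    ultimately obtain R' where "R' \<in> L" "R - [:of_int m:] = smult (of_nat p ^ j) R'"
      using divisible_by_power_iff[OF _ p(1), of "R - [:of_int m:]" j] p(2) by auto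
    moreover have "smult (of_int m) 1 = [:of_int m :: rat:]" by (simp add: one_pCons)
    ultimately show ?thesis by (intro exI[of _ m] bexI[of _ R']) (auto simp: algebra_simps)
  qed
  have "val_ge p (s p) (int j - 2 * int k) D" for j
  proof -
    obtain m P' where P': "P' \<in> L" "P = smult (of_int m) 1 + smult (of_nat p ^ j) P'"
      using approx[OF P] by blast
    obtain l Q' where Q': "Q' \<in> L" "Q = smult (of_int l) 1 + smult (of_nat p ^ j) Q'"
      using approx[OF Q] by blast
    have "\<beta> P Q = smult (of_int m) (\<beta> 1 Q) + smult (of_nat p ^ j) (\<beta> P' Q)"
      unfolding P'(2)
      using add1[OF smult_closed[OF one_in_lattice] pow[OF P'(1)] Q(1)]
        smult1[OF _ _ Q(1) one_in_lattice] pow1[OF P'(1) Q(1)] Q(1) by simp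
    also have "\<beta> 1 Q = smult (of_int l) (\<beta> 1 1) + smult (of_nat p ^ j) (\<beta> 1 Q')"
      unfolding Q'(2)
      using add2[OF one_in_lattice smult_closed[OF one_in_lattice] pow[OF Q'(1)]]
        smult2[OF one_in_lattice _ _ one_in_lattice] pow2[OF one_in_lattice Q'(1)] one_in_lattice
      by simp
    finally have "\<beta> P Q = smult (of_int m * of_int l) (\<beta> 1 1)
        + smult (of_nat p ^ j) (smult (of_int m) (\<beta> 1 Q') + \<beta> P' Q)"
      by (simp add: smult_add_right algebra_simps)
    moreover have "P * Q = [:of_int m * of_int l:]
        + smult (of_nat p ^ j) (smult (of_int m) Q' + P' * Q)"
    proof -
      have "P * Q = smult (of_int m) Q + smult (of_nat p ^ j) (P' * Q)"
        by (subst P'(2)) (simp add: algebra_simps)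
      also have "smult (of_int m) Q = [:of_int m * of_int l:] + smult (of_nat p ^ j) (smult (of_int m) Q')"
        by (subst Q'(2)) (simp add: smult_add_right algebra_simps one_pCons)
      finally show ?thesis by (simp add: smult_add_right algebra_simps)
    qed
    ultimately have D: "D = smult (of_nat p ^ j) ((smult (of_int m) (\<beta> 1 Q') + \<beta> P' Q)
        - \<beta> 1 1 * (smult (of_int m) Q' + P' * Q))"
      unfolding D_def mult.assoc by (simp add: smult_diff_right smult_add_right algebra_simps)
    have val: "val_ge p (s p) (- int k) R" if "R \<in> L" for R
      using lattice_val_ge[OF that p] .
    have "val_ge p (s p) (- int k) (smult (of_int m) (\<beta> 1 Q') + \<beta> P' Q)"
      using val closed one_in_lattice Q'(1) P'(1) Q(1) add_closed smult_closed by metis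
    then have 1: "val_ge p (s p) (- 2 * int k) (smult (of_int m) (\<beta> 1 Q') + \<beta> P' Q)"
      by (rule p.val_ge_mono) simp
    have "val_ge p (s p) (- int k) (smult (of_int m) Q')"
      using val Q'(1) smult_closed by blast
    moreover have "val_ge p (s p) (- int k) (P' * Q)"
      using p.val_ge_mult[OF val[OF P'(1)] Q(2)] by simp
    ultimately have "val_ge p (s p) (- int k) (smult (of_int m) Q' + P' * Q)"
      by (rule p.val_ge_add)
    from p.val_ge_mult[OF val[OF closed[OF one_in_lattice one_in_lattice]] this]
    have 2: "val_ge p (s p) (- 2 * int k) (\<beta> 1 1 * (smult (of_int m) Q' + P' * Q))" by simp
    show ?thesis
      unfolding D p.val_ge_smult_power using p.val_ge_diff[OF 1 2] by simp
  qed
  then have "D = 0" by (rule zero_if_all_val_ge[OF p(1)])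
  then show ?thesis by (simp add: D_def)
qed

text \<open>
  By \<open>biadditive_eq_mult\<close> a multiplication is $c P Q$ on integer polynomials, with $c = \beta(1, 1)$.
  Degrees force $c = 0$, and clearing denominators extends this to all of the group.
\<close>
lemma nil_lattice: "nil_group G"
proof (rule nil_group_if_no_biadditive[OF comm_group_coeff_group])
  fix b :: "(nat \<Rightarrow> rat) \<Rightarrow> (nat \<Rightarrow> rat) \<Rightarrow> nat \<Rightarrow> rat" and x y
  assume b_closed: "\<And>x y. x \<in> carrier G \<Longrightarrow> y \<in> carrier G \<Longrightarrow> b x y \<in> carrier G"
    and b1: "\<And>x x' y. \<lbrakk>x \<in> carrier G; x' \<in> carrier G; y \<in> carrier G\<rbrakk> \<Longrightarrow>
          b (x \<otimes>\<^bsub>G\<^esub> x') y = b x y \<otimes>\<^bsub>G\<^esub> b x' y"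
    and b2: "\<And>x y y'. \<lbrakk>x \<in> carrier G; y \<in> carrier G; y' \<in> carrier G\<rbrakk> \<Longrightarrow>
          b x (y \<otimes>\<^bsub>G\<^esub> y') = b x y \<otimes>\<^bsub>G\<^esub> b x y'"
    and xy: "x \<in> carrier G" "y \<in> carrier G"
  define \<beta> where "\<beta> P Q = inv_into L coeff (b (coeff P) (coeff Q))" for P Q
  have \<beta>: "\<beta> P Q \<in> L \<and> coeff (\<beta> P Q) = b (coeff P) (coeff Q)" if "P \<in> L" "Q \<in> L" for P Q
    using b_closed[of "coeff P" "coeff Q"] that inv_into_into[of _ coeff L] f_inv_into_f[of _ coeff L]
    unfolding \<beta>_def by simp
  have mem: "coeff P \<in> carrier G" if "P \<in> L" for P using that by simp
  have add1: "\<beta> (P + P') Q = \<beta> P Q + \<beta> P' Q" if "P \<in> L" "P' \<in> L" "Q \<in> L" for P P' Q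
  proof -
    have "coeff (\<beta> (P + P') Q) = b (coeff P \<otimes>\<^bsub>G\<^esub> coeff P') (coeff Q)"
      using \<beta>[OF add_closed[OF that(1,2)] that(3)] by (simp add: add_coeff)
    also have "\<dots> = coeff (\<beta> P Q + \<beta> P' Q)"
      using b1[OF mem[OF that(1)] mem[OF that(2)] mem[OF that(3)]] \<beta> that by (simp add: fun_eq_iff)
    finally show ?thesis by (simp add: coeff_inject)
  qed
  have add2: "\<beta> P (Q + Q') = \<beta> P Q + \<beta> P Q'" if "P \<in> L" "Q \<in> L" "Q' \<in> L" for P Q Q'
  proof -
    have "coeff (\<beta> P (Q + Q')) = b (coeff P) (coeff Q \<otimes>\<^bsub>G\<^esub> coeff Q')"
      using \<beta>[OF that(1) add_closed[OF that(2,3)]] by (simp add: add_coeff)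
    also have "\<dots> = coeff (\<beta> P Q + \<beta> P Q')"
      using b2[OF mem[OF that(1)] mem[OF that(2)] mem[OF that(3)]] \<beta> that by (simp add: fun_eq_iff)
    finally show ?thesis by (simp add: coeff_inject)
  qed
  obtain p k where p: "prime p" "\<chi> p = enat k" using finite_place by auto
  interpret p: padic_integer p "s p" by (rule padic[OF p(1)])
  have integer: "P \<in> L" "val_ge p (s p) 0 P" if P: "degree P < n" "\<And>i. coeff P i \<in> \<int>" for P
  proof -
    show "P \<in> L" by (rule integer_poly_in_lattice[OF P])
    have "p_integral p (coeff P i)" for i
      using P(2)[of i] by (elim Ints_cases) (simp add: p)
    then show "val_ge p (s p) 0 P" by (rule p.val_ge_integral)
  qed
  have mult: "\<beta> P Q = \<beta> 1 1 * P * Q"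
    if "degree P < n" "\<And>i. coeff P i \<in> \<int>" "degree Q < n" "\<And>i. coeff Q i \<in> \<int>" for P Q
    using biadditive_eq_mult[of \<beta>, OF _ add1 add2 p integer[OF that(1,2)] integer[OF that(3,4)]] \<beta>
    by blast
  have "\<beta> 1 1 = 0"
  proof (rule ccontr)
    assume nz: "\<beta> 1 1 \<noteq> 0"
    define X where "X = (monom 1 (n - 1) :: rat poly)"
    have X: "degree X = n - 1" "X \<noteq> 0" "\<And>i. coeff X i \<in> \<int>"
      by (auto simp: X_def degree_monom_eq)
    then have eq: "\<beta> X X = \<beta> 1 1 * X * X" using n_gt_1 by (intro mult) auto
    have "degree (\<beta> 1 1 * X * X) = degree (\<beta> 1 1) + (n - 1) + (n - 1)"
      using nz X by (simp add: degree_mult_eq)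
    moreover have "degree (\<beta> X X) < n"
      using \<beta> integer[of X] X n_gt_1 lattice_degree by (metis diff_less less_trans zero_less_one)
    ultimately show False using eq n_gt_1 by simp
  qed
  obtain P Q where PQ: "P \<in> L" "x = coeff P" "Q \<in> L" "y = coeff Q" using xy by auto
  obtain d :: nat where d: "d > 0" "\<And>i. coeff (smult (of_nat d) P) i \<in> \<int>"
    using common_denominator[of P] by blast
  obtain e :: nat where e: "e > 0" "\<And>i. coeff (smult (of_nat e) Q) i \<in> \<int>"
    using common_denominator[of Q] by blast
  have "\<beta> (smult (of_nat d) P) (smult (of_nat e) Q) = 0"
    using mult[OF _ d(2) _ e(2)] lattice_degree[OF PQ(1)] lattice_degree[OF PQ(3)] \<open>\<beta> 1 1 = 0\<close>
    by simp
  also have "\<beta> (smult (of_nat d) P) (smult (of_nat e) Q) = smult (of_nat d) (smult (of_nat e) (\<beta> P Q))"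
    using additive_smult[OF poly_subgroup_axioms, of "\<lambda>P. \<beta> P (smult (of_nat e) Q)" P "int d"]
      additive_smult[OF poly_subgroup_axioms, of "\<beta> P" Q "int e"]
      add1[OF _ _ smult_nat_closed[OF PQ(3)]] add2[OF PQ(1)] PQ by simp
  finally have "\<beta> P Q = 0" using d(1) e(1) by simp
  then show "b x y = \<one>\<^bsub>G\<^esub>" using \<beta>[OF PQ(1,3)] unfolding PQ(2,4) by (simp add: fun_eq_iff)
qed

lemma NIL_lattice: "NIL G"
  unfolding NIL_def
  using comm_group_coeff_group torsion_free_coeff_group has_rank_lattice nil_lattice by blast

end

section \<open>Quasi-isomorphic lattices\<close>

lemma quasi_isomorphic_refl:
  assumes "group A" shows "quasi_isomorphic A A"
  unfolding quasi_isomorphic_def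
proof (intro exI conjI)
  show "subgroup (carrier A) A" "subgroup (carrier A) A"
    using group.subgroup_self[OF assms] by blast+
  show "A\<lparr>carrier := carrier A\<rparr> \<cong> A\<lparr>carrier := carrier A\<rparr>" by (rule iso_refl)
  show "(0::nat) < 1" "(0::nat) < 1" by simp_all
  interpret group A by (rule assms)
  show "multiples A 1 \<subseteq> carrier A" "multiples A 1 \<subseteq> carrier A"
    by (auto simp: multiples_def)
qed

lemma quasi_isomorphic_sym:
  assumes "group A" "quasi_isomorphic A B" shows "quasi_isomorphic B A"
proof -
  obtain A' B' and m n :: nat where *: "subgroup A' A" "subgroup B' B"
    "A\<lparr>carrier := A'\<rparr> \<cong> B\<lparr>carrier := B'\<rparr>"
    "m > 0" "n > 0" "multiples A m \<subseteq> A'" "multiples B n \<subseteq> B'"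
    using assms(2) unfolding quasi_isomorphic_def by blast
  have "B\<lparr>carrier := B'\<rparr> \<cong> A\<lparr>carrier := A'\<rparr>"
    using group.iso_sym[OF subgroup.subgroup_is_group[OF *(1) assms(1)] *(3)] .
  then show ?thesis unfolding quasi_isomorphic_def using * by blast
qed

text \<open>
  For the limits $a$ of \<open>s\<close> and $b$ of \<open>s'\<close> this expresses the equation $P(b) a = Q(b)$ through the
  integers $m$ close to $a$: they satisfy $P(b) m \approx Q(b)$, up to a bounded loss of precision.
\<close>
definition solves_for_point ::
    "nat \<Rightarrow> (nat \<Rightarrow> int) \<Rightarrow> (nat \<Rightarrow> int) \<Rightarrow> rat poly \<Rightarrow> rat poly \<Rightarrow> bool" where
  "solves_for_point p s s' P Q \<longleftrightarrow> P \<noteq> 0 \<and>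
     (\<exists>c. \<forall>j m. val_ge p s (int j) [:- of_int m, 1:] \<longrightarrow>
        val_ge p s' (int j - c) (Q - smult (of_int m) P))"

text \<open>
  Homomorphisms are continuous for the $p$-adic topology. If $m$ is close to $a$ then $X - m$ is
  divisible by a high power of $p$, hence so is its image $Q - m P$, where $P$ and $Q$ are the images of
  $1$ and $X$. The multiple \<open>M\<close> only serves to reach the domain of the isomorphism.
\<close>
lemma quasi_isomorphic_imp_solves_for_point:
  assumes "transcendental_lattice n \<chi> s" "transcendental_lattice n \<chi> s'"
    and "quasi_isomorphic (coeff_group (padic_lattice n \<chi> s)) (coeff_group (padic_lattice n \<chi> s'))"
    and p: "prime p" "\<chi> p = enat k"
  shows "\<exists>P Q. solves_for_point p (s p) (s' p) P Q"
proof -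
  interpret S: transcendental_lattice n \<chi> s by (rule assms(1))
  interpret T: transcendental_lattice n \<chi> s' by (rule assms(2))
  interpret sp: padic_integer p "s p" by (rule S.padic[OF p(1)])
  interpret tp: padic_integer p "s' p" by (rule T.padic[OF p(1)])
  obtain A' B' and M N :: nat where AB: "subgroup A' S.G" "subgroup B' T.G"
    "S.G\<lparr>carrier := A'\<rparr> \<cong> T.G\<lparr>carrier := B'\<rparr>"
    "M > 0" "multiples S.G M \<subseteq> A'"
    using assms(3) unfolding quasi_isomorphic_def by blast
  then obtain f where "f \<in> iso (S.G\<lparr>carrier := A'\<rparr>) (T.G\<lparr>carrier := B'\<rparr>)"
    unfolding is_iso_def by blast
  then have f_hom: "f \<in> hom (S.G\<lparr>carrier := A'\<rparr>) (T.G\<lparr>carrier := B'\<rparr>)" and f_inj: "inj_on f A'"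
    unfolding iso_def bij_betw_def by auto
  define g where "g P = inv_into T.L coeff (f (coeff (smult (of_nat M) P)))" for P
  have mem: "coeff (smult (of_nat M) P) \<in> A'" if "P \<in> S.L" for P
    using AB(5) that unfolding S.multiples_coeff_group by auto
  have g: "g P \<in> T.L \<and> coeff (g P) = f (coeff (smult (of_nat M) P))" if "P \<in> S.L" for P
  proof -
    have "f (coeff (smult (of_nat M) P)) \<in> B'"
      using hom_in_carrier[OF f_hom] mem[OF that] by simp
    then have "f (coeff (smult (of_nat M) P)) \<in> coeff ` T.L"
      using subgroup.subset[OF AB(2)] by auto
    then show ?thesis unfolding g_def by (simp add: inv_into_into f_inv_into_f)
  qed
  have g_add: "g (P + Q) = g P + g Q" if "P \<in> S.L" "Q \<in> S.L" for P Q
  proof -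
    have "coeff (g (P + Q)) = f (coeff (smult (of_nat M) P) \<otimes>\<^bsub>S.G\<^esub> coeff (smult (of_nat M) Q))"
      using g[OF S.add_closed[OF that]]
      by (simp only: smult_add_right coeff_group_simps S.add_coeff)
    also have "\<dots> = coeff (g P + g Q)"
      using hom_mult[OF f_hom, of "coeff (smult (of_nat M) P)" "coeff (smult (of_nat M) Q)"]
        mem g that by (simp add: fun_eq_iff)
    finally show ?thesis by (simp add: coeff_inject)
  qed
  have g_smult: "g (smult (of_int m) P) = smult (of_int m) (g P)" if "P \<in> S.L" for m P
    using additive_smult[OF S.poly_subgroup_axioms, of g, OF g_add that] .
  have "g 1 \<noteq> 0"
  proof
    assume "g 1 = 0"
    moreover have "g 0 = 0" using g_smult[OF S.zero_closed, of 0] by simp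
    ultimately have "f (coeff (smult (of_nat M) 1)) = f (coeff (smult (of_nat M) 0))"
      using g[OF S.one_in_lattice] g[OF S.zero_closed] by metis
    then have "coeff (smult (of_nat M) 1 :: rat poly) = coeff (smult (of_nat M) 0)"
      using inj_onD[OF f_inj] mem S.one_in_lattice S.zero_closed by blast
    then show False using AB(4) by (simp add: coeff_inject)
  qed
  moreover
  define X where "X = ([:0, 1:] :: rat poly)"
  have X: "X \<in> S.L"
    using S.n_gt_1 unfolding X_def
    by (intro S.integer_poly_in_lattice) (auto simp: coeff_pCons split: nat.splits)
  have "val_ge p (s' p) (int j - int k) (g X - smult (of_int m) (g 1))"
    if "val_ge p (s p) (int j) [:- of_int m, 1:]" for j m
  proof -
    have split: "[:- of_int m, 1:] = X + smult (of_int (- m)) 1"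
      by (simp add: X_def one_pCons)
    have L: "[:- of_int m, 1:] \<in> S.L"
      unfolding split using S.add_closed S.smult_closed X S.one_in_lattice by blast
    have "val_ge p (s p) (int j - int k) [:- of_int m, 1:]"
      by (rule sp.val_ge_mono[OF that]) simp
    then obtain Y where Y: "Y \<in> S.L" "[:- of_int m, 1:] = smult (of_nat p ^ j) Y"
      using S.divisible_by_power_iff[OF L p(1), of j] p(2) by auto
    have "g X - smult (of_int m) (g 1) = g [:- of_int m, 1:]"
      unfolding split
      using g_add[OF X S.smult_closed[OF S.one_in_lattice, of "- m"]] g_smult[OF S.one_in_lattice, of "- m"]
      by simp
    also have "\<dots> = smult (of_nat p ^ j) (g Y)"
      unfolding Y(2) using g_smult[OF Y(1), of "int p ^ j"] by simp
    finally show ?thesis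
      using T.lattice_val_ge[OF _ p] g[OF Y(1)] by (simp add: tp.val_ge_smult_power)
  qed
  ultimately show ?thesis unfolding solves_for_point_def by blast
qed

text \<open>
  The equation $P(b) a = Q(b)$ has at most one solution $a$ because $P(b) \neq 0$. In terms of
  approximations: the partial sums for \<open>S\<close> and \<open>T\<close> differ by $p^e u$ with a fixed $e$, so
  $p^e P(b)$ would be divisible by arbitrarily high powers of $p$.
\<close>
lemma solves_for_point_unique:
  assumes p: "prime p" and s': "padic_integer p s'" "\<And>P. P \<noteq> 0 \<Longrightarrow> \<exists>k. \<not> val_ge p s' k P"
    and S: "solves_for_point p (\<lambda>i. int (liouville p r S i)) s' P Q"
    and T: "solves_for_point p (\<lambda>i. int (liouville p r T i)) s' P Q"
  shows "S = T"
proof (rule ccontr)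
  assume "S \<noteq> T"
  interpret p: padic_integer p s' by (rule s'(1))
  interpret S: liouville_number p r S by (rule liouville_number.intro[OF p])
  interpret T: liouville_number p r T by (rule liouville_number.intro[OF p])
  obtain e where e: "\<forall>\<^sub>F i in sequentially.
      \<exists>u. int (S.l i) - int (T.l i) = int p ^ e * u \<and> \<not> int p dvd u"
    using liouville_difference[OF p \<open>S \<noteq> T\<close>, of r] by blast
  obtain c where c: "\<And>j m. val_ge p (\<lambda>i. int (S.l i)) (int j) [:- of_int m, 1:] \<Longrightarrow>
      val_ge p s' (int j - c) (Q - smult (of_int m) P)"
    using S unfolding solves_for_point_def by blast
  obtain d where d: "\<And>j m. val_ge p (\<lambda>i. int (T.l i)) (int j) [:- of_int m, 1:] \<Longrightarrow>
      val_ge p s' (int j - d) (Q - smult (of_int m) P)"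
    using T unfolding solves_for_point_def by blast
  have "P \<noteq> 0" using S unfolding solves_for_point_def by blast
  have all: "val_ge p s' (int j - max c d - int e) P" for j
  proof -
    obtain i u where i: "val_ge p (\<lambda>i. int (S.l i)) (int j) [:- of_int (int (S.l i)), 1:]"
      "val_ge p (\<lambda>i. int (T.l i)) (int j) [:- of_int (int (T.l i)), 1:]"
      and u: "int (S.l i) - int (T.l i) = int p ^ e * u" "\<not> int p dvd u"
      using eventually_happens[OF eventually_conj[OF S.eventually_val_ge_linear[of j]
          eventually_conj[OF T.eventually_val_ge_linear[of j] e]]] by auto
    have "val_ge p s' (int j - max c d) (Q - smult (of_int (int (T.l i))) P)"
      by (rule p.val_ge_mono[OF d[OF i(2)]]) simp
    moreover have "val_ge p s' (int j - max c d) (Q - smult (of_int (int (S.l i))) P)"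
      by (rule p.val_ge_mono[OF c[OF i(1)]]) simp
    ultimately have "val_ge p s' (int j - max c d)
        ((Q - smult (of_int (int (T.l i))) P) - (Q - smult (of_int (int (S.l i))) P))"
      by (rule p.val_ge_diff)
    also have "(Q - smult (of_int (int (T.l i))) P) - (Q - smult (of_int (int (S.l i))) P)
        = smult (of_int (int (S.l i) - int (T.l i))) P"
      by (simp add: smult_diff_left)
    also have "\<dots> = smult (of_nat p ^ e) (smult (of_int u) P)"
      by (simp add: u(1))
    finally show ?thesis unfolding p.val_ge_smult_power p.val_ge_smult_unit[OF u(2)] .
  qed
  obtain k where "\<not> val_ge p s' k P" using s'(2)[OF \<open>P \<noteq> 0\<close>] by blast
  then show False
    using p.val_ge_mono[OF all[of "nat (k + max c d + int e)"], of k] by simp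
qed

section \<open>Lattices at Liouville numbers\<close>

text \<open>
  Modulo $p$ the point is $r = \lfloor p^{1/n} \rfloor$, which tends to infinity with $p$. For an
  integer polynomial of degree less than $n$ this gives $0 < |P(r)| < r^n \le p$ for all large $p$.
\<close>
lemma almost_all_liouville_unit:
  assumes "P \<noteq> 0" "degree P < n"
  shows "finite {p. prime p \<and>
    \<not> (val_ge p (\<lambda>i. int (liouville p (root_floor n p) S i)) 0 P \<and>
       \<not> val_ge p (\<lambda>i. int (liouville p (root_floor n p) S i)) 1 P)}"
proof -
  have "n > 0" using assms(2) by simp
  obtain d :: nat where d: "d > 0" "\<And>i. coeff (smult (of_nat d) P) i \<in> \<int>"
    using common_denominator[of P] by blast
  define Q where "Q = smult (of_nat d) P"
  have Q: "Q \<noteq> 0" "degree Q < n" "\<And>i. coeff Q i \<in> \<int>" using assms d by (auto simp: Q_def)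
  obtain R where R: "\<And>y :: nat. y \<ge> R \<Longrightarrow>
      poly Q (of_nat y) \<noteq> 0 \<and> \<bar>poly Q (of_nat y)\<bar> < of_nat y ^ n"
    using poly_eventually_small_nonzero[OF Q(1,2)] by blast
  have "val_ge p (\<lambda>i. int (liouville p (root_floor n p) S i)) 0 P \<and>
      \<not> val_ge p (\<lambda>i. int (liouville p (root_floor n p) S i)) 1 P"
    if p: "prime p" "p > max d (R ^ n)" for p
  proof -
    define r where "r = root_floor n p"
    interpret S: liouville_number p r S by (rule liouville_number.intro[OF p(1)])
    have "\<not> int p dvd int d" using p(2) d(1) by (auto dest: dvd_imp_le)
    then have unit: "val_ge p (\<lambda>i. int (S.l i)) k Q \<longleftrightarrow> val_ge p (\<lambda>i. int (S.l i)) k P" for k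
      using S.val_ge_smult_unit[of "int d" k P] by (simp add: Q_def)
    have int: "p_integral p (coeff Q i)" for i
      using Q(3)[of i] by (elim Ints_cases) (simp add: p)
    have "r \<ge> R" unfolding r_def using p(2) by (intro le_root_floor[OF \<open>n > 0\<close>]) simp
    obtain m where m: "poly Q (of_nat r) = of_int m"
      using poly_in_Ints[OF Q(3) Ints_of_nat[of r]] by (elim Ints_cases)
    have "m \<noteq> 0" using R[OF \<open>r \<ge> R\<close>] m by simp
    have "(of_int \<bar>m\<bar> :: rat) < of_int (int (r ^ n))" using R[OF \<open>r \<ge> R\<close>] m by simp
    then have "\<bar>m\<bar> < int (r ^ n)" by (simp only: of_int_less_iff)
    also have "\<dots> \<le> int p" using root_floor_power_le[OF \<open>n > 0\<close>, of p] by (simp only: r_def of_nat_le_iff)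
    finally have "\<not> int p dvd m" using \<open>m \<noteq> 0\<close> by (metis dvd_abs_iff zdvd_not_zless zero_less_abs_iff)
    have "\<not> val_ge p (\<lambda>i. int (S.l i)) 1 Q"
    proof
      assume "val_ge p (\<lambda>i. int (S.l i)) 1 Q"
      then obtain i where "p_integral p (of_nat p powi (- 1) * poly Q (of_int (int (S.l i))))"
        unfolding val_ge_def by (meson eventually_happens sequentially_bot)
      moreover have "p_integral p ((poly Q (of_int (int (S.l i))) - poly Q (of_int (int r))) / of_nat p ^ 1)"
        using S.liouville_cong_start by (intro p_integral_poly_diff[OF p(1) int]) simp
      ultimately have "p_integral p (of_nat p powi (- 1) * poly Q (of_int (int (S.l i)))
          - (poly Q (of_int (int (S.l i))) - poly Q (of_int (int r))) / of_nat p ^ 1)"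
        by (rule p_integral_diff[OF p(1)])
      also have "of_nat p powi (- 1) * poly Q (of_int (int (S.l i)))
          - (poly Q (of_int (int (S.l i))) - poly Q (of_int (int r))) / of_nat p ^ 1
          = of_int m / of_nat p ^ 1"
        using m by (simp add: power_int_minus divide_inverse algebra_simps)
      finally have "int p ^ 1 dvd m" using p_integral_divide_power_iff[OF p(1)] by blast
      then show False using \<open>\<not> int p dvd m\<close> by simp
    qed
    moreover have "val_ge p (\<lambda>i. int (S.l i)) 0 Q" by (rule S.val_ge_integral[OF int])
    ultimately show ?thesis using unit by (simp add: r_def)
  qed
  then have "{p. prime p \<and>
    \<not> (val_ge p (\<lambda>i. int (liouville p (root_floor n p) S i)) 0 P \<and>
       \<not> val_ge p (\<lambda>i. int (liouville p (root_floor n p) S i)) 1 P)} \<subseteq> {..max d (R ^ n)}"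
    by (auto simp: not_less[symmetric])
  then show ?thesis by (rule finite_subset) simp
qed

lemma transcendental_lattice_liouville:
  assumes "n > 1" "\<exists>p. prime p \<and> \<chi> p \<noteq> \<infinity>"
  shows "transcendental_lattice n \<chi> (\<lambda>p i. int (liouville p (root_floor n p) S i))"
proof (rule transcendental_lattice.intro)
  show "padic_integer p (\<lambda>i. int (liouville p (root_floor n p) S i))" if "prime p" for p
  proof -
    interpret S: liouville_number p "root_floor n p" S by (rule liouville_number.intro[OF that])
    show ?thesis by (rule S.padic_integer_axioms)
  qed
next
  fix p P assume p: "prime (p :: nat)"
  interpret S: liouville_number p "root_floor n p" S by (rule liouville_number.intro[OF p])
  show "P \<noteq> 0 \<Longrightarrow> \<exists>k. \<not> val_ge p (\<lambda>i. int (S.l i)) k P"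
    using S.liouville_transcendental by blast
qed (use assms almost_all_liouville_unit in auto)

section \<open>Continuum many classes\<close>

text \<open>
  By maximality the countable classes of the elements of a maximal unrelated set \<open>M\<close> cover the type.
  So \<open>M\<close> is uncountable, and a union of countable sets indexed by \<open>M\<close> is no larger than \<open>M\<close>.
\<close>
lemma ex_large_pairwise_unrelated_set:
  assumes uncountable: "uncountable (UNIV :: 'a set)"
    and sym: "\<And>x y. R x y \<Longrightarrow> R y x"
    and countable: "\<And>y. countable {x :: 'a. R x y}"
  obtains M where "M \<approx> (UNIV :: 'a set)" "pairwise (\<lambda>x y. \<not> R x y) M"
proof -
  define \<F> where "\<F> = {M. pairwise (\<lambda>x y. \<not> R x y) M}"
  have "\<exists>M\<in>\<F>. \<forall>X\<in>\<F>. M \<subseteq> X \<longrightarrow> X = M"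
  proof (rule subset_Zorn')
    fix C assume "subset.chain \<F> C"
    then have "C \<subseteq> \<F>" "\<And>X Y. X \<in> C \<Longrightarrow> Y \<in> C \<Longrightarrow> X \<subseteq> Y \<or> Y \<subseteq> X"
      by (auto simp: subset_chain_def)
    then show "\<Union>C \<in> \<F>"
      unfolding \<F>_def pairwise_def by (smt (verit) Union_iff mem_Collect_eq subsetD)
  qed
  then obtain M where M: "pairwise (\<lambda>x y. \<not> R x y) M"
    and max: "\<And>X. pairwise (\<lambda>x y. \<not> R x y) X \<Longrightarrow> M \<subseteq> X \<Longrightarrow> X = M"
    unfolding \<F>_def by blast
  define E where "E y = insert y {x. R x y}" for y
  have E: "countable (E y)" for y unfolding E_def using countable by simp
  have cover: "(\<Union>y\<in>M. E y) = UNIV"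
  proof (intro equalityI subsetI)
    fix x :: 'a
    show "x \<in> (\<Union>y\<in>M. E y)"
    proof (rule ccontr)
      assume *: "x \<notin> (\<Union>y\<in>M. E y)"
      then have "x \<notin> M" "\<And>y. y \<in> M \<Longrightarrow> \<not> R x y" "\<And>y. y \<in> M \<Longrightarrow> \<not> R y x"
        unfolding E_def using sym by auto
      then have "pairwise (\<lambda>x y. \<not> R x y) (insert x M)"
        using M by (simp add: pairwise_insert)
      then show False using max[of "insert x M"] \<open>x \<notin> M\<close> by blast
    qed
  qed simp
  have "uncountable M"
  proof
    assume "countable M"
    then have "countable (\<Union>y\<in>M. E y)" using E by (intro countable_UN)
    then show False using cover uncountable by simp
  qed
  then have inf: "infinite M" using countable_finite by blast
  have "|E y| \<le>o |M|" for y
  proof -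
    have "|E y| \<le>o |UNIV :: nat set|"
      using E[of y] unfolding countable_def card_of_ordLeq[symmetric] by auto
    also have "|UNIV :: nat set| \<le>o |M|" using inf infinite_iff_card_of_nat by blast
    finally show ?thesis .
  qed
  then have "|\<Union>y\<in>M. E y| \<le>o |M|"
    by (intro card_of_UNION_ordLeq_infinite[OF inf]) (auto simp: card_of_refl ordIso_imp_ordLeq)
  then have "(UNIV :: 'a set) \<lesssim> M" unfolding cover lepoll_def card_of_ordLeq[symmetric] by blast
  moreover have "M \<lesssim> (UNIV :: 'a set)" by (rule subset_imp_lepoll) simp
  ultimately have "M \<approx> (UNIV :: 'a set)" by (simp add: lepoll_antisym)
  then show ?thesis using that M by blast
qed

theorem theorem15:
  fixes n :: nat and t :: "(nat \<Rightarrow> enat) set"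
  assumes "n > 1" and "t \<in> types" and "t \<noteq> type_of_char (\<lambda>p. \<infinity>)"
  shows "\<exists>\<G> :: (nat \<Rightarrow> rat) monoid set.
           \<G> \<approx> (UNIV :: nat set set) \<and>
           (\<forall>G\<in>\<G>. MH G \<and> NIL G \<and> has_rank G n \<and> group_type G = t) \<and>
           pairwise (\<lambda>A B. \<not> quasi_isomorphic A B) \<G>"
proof -
  obtain \<chi> where \<chi>: "t = type_of_char \<chi>"
    using assms(2) unfolding types_def type_of_char_def by (rule quotientE)
  have "\<exists>p. prime p \<and> \<chi> p \<noteq> \<infinity>"
  proof (rule ccontr)
    assume *: "\<not> (\<exists>p. prime p \<and> \<chi> p \<noteq> \<infinity>)"
    then have "{p. prime p \<and> \<chi> p \<noteq> \<infinity>} = {}" by blast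
    then have "finite {p. prime p \<and> \<chi> p \<noteq> \<infinity>}" by (simp only: finite.emptyI)
    then have "(\<chi>, \<lambda>p. \<infinity>) \<in> char_rel" unfolding char_rel_def using * by blast
    then show False
      using assms(3) \<chi> equiv_class_eq[OF equiv_char_rel] unfolding type_of_char_def by metis
  qed
  then obtain p k where p: "prime p" "\<chi> p = enat k" by auto
  \<comment> \<open>the same set of digits is used at all primes\<close>
  define s where "s S p i = int (liouville p (root_floor n p) S i)" for S p i
  define \<Gamma> where "\<Gamma> S = coeff_group (padic_lattice n \<chi> (s S))" for S
  have lattice: "transcendental_lattice n \<chi> (s S)" for S
    using transcendental_lattice_liouville[OF assms(1) \<open>\<exists>p. prime p \<and> \<chi> p \<noteq> \<infinity>\<close>, of S]
    unfolding s_def .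
  have group: "group (\<Gamma> S)" for S
  proof -
    interpret transcendental_lattice n \<chi> "s S" by (rule lattice)
    show ?thesis unfolding \<Gamma>_def by (rule is_group)
  qed
  have countable: "countable {S. quasi_isomorphic (\<Gamma> S) (\<Gamma> T)}" for T
  proof -
    interpret T: transcendental_lattice n \<chi> "s T" by (rule lattice)
    \<comment> \<open>mapping \<open>S\<close> to a pair of rational polynomials that solves for its point is injective\<close>
    define C where "C S PQ \<longleftrightarrow> solves_for_point p (s S p) (s T p) (fst PQ) (snd PQ)"
      for S and PQ :: "rat poly \<times> rat poly"
    define w where "w S = (SOME PQ. C S PQ)" for S
    have w: "C S (w S)" if qi: "quasi_isomorphic (\<Gamma> S) (\<Gamma> T)" for S
    proof -
      obtain P Q where "C S (P, Q)"
        using quasi_isomorphic_imp_solves_for_point[OF lattice lattice qi[unfolded \<Gamma>_def] p]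
        unfolding C_def by auto
      then show ?thesis unfolding w_def by (rule someI)
    qed
    have "inj_on w {S. quasi_isomorphic (\<Gamma> S) (\<Gamma> T)}"
    proof (rule inj_onI)
      fix S S' assume "S \<in> {S. quasi_isomorphic (\<Gamma> S) (\<Gamma> T)}"
        "S' \<in> {S. quasi_isomorphic (\<Gamma> S) (\<Gamma> T)}" "w S = w S'"
      then have "C S (w S)" "C S' (w S)" using w[of S] w[of S'] by auto
      then show "S = S'"
        unfolding C_def s_def
        by (intro solves_for_point_unique[OF p(1) T.padic[OF p(1), unfolded s_def]
              T.separated[OF p(1), unfolded s_def]])
    qed
    moreover have "inj (map_prod coeffs coeffs :: rat poly \<times> rat poly \<Rightarrow> _)"
      by (intro prod.inj_map) (auto simp: inj_def coeffs_eq_iff)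
    then have "countable (UNIV :: (rat poly \<times> rat poly) set)"
      by (rule countableI')
    ultimately show ?thesis by (metis countable_image_inj_on countable_subset subset_UNIV)
  qed
  have "uncountable (UNIV :: nat set set)"
    using Cantors_theorem[of "UNIV :: nat set"] range_from_nat_into[of "UNIV :: nat set set"]
    by (metis Pow_UNIV UNIV_not_empty)
  then obtain M where M: "M \<approx> (UNIV :: nat set set)"
    "pairwise (\<lambda>S T. \<not> quasi_isomorphic (\<Gamma> S) (\<Gamma> T)) M"
    using ex_large_pairwise_unrelated_set[of "\<lambda>S T. quasi_isomorphic (\<Gamma> S) (\<Gamma> T)"]
      quasi_isomorphic_sym[OF group] countable by blast
  have "inj_on \<Gamma> M"
    using M(2) quasi_isomorphic_refl[OF group] unfolding pairwise_def by (intro inj_onI) metis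
  then have "\<Gamma> ` M \<approx> (UNIV :: nat set set)"
    using M(1) eqpoll_trans inj_on_image_eqpoll_self by blast
  moreover have "MH (\<Gamma> S) \<and> NIL (\<Gamma> S) \<and> has_rank (\<Gamma> S) n \<and> group_type (\<Gamma> S) = t" for S
  proof -
    interpret transcendental_lattice n \<chi> "s S" by (rule lattice)
    show ?thesis
      unfolding \<Gamma>_def \<chi> using MH_lattice NIL_lattice has_rank_lattice group_type_lattice by blast
  qed
  moreover have "pairwise (\<lambda>A B. \<not> quasi_isomorphic A B) (\<Gamma> ` M)"
    using M(2) by (auto simp: pairwise_def)
  ultimately show ?thesis by blast
qed

end
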